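(* Let $q$ be a prime power and $2\le\ell\le m$ integers. For $1\le r\le\ell m$ let $\hat d_r$ denote the $r$-th generalized Hamming weight of $\hat C_{\det}(1;\ell,m)$, and recall $\hat d_m=q^{\ell-1}\frac{q^m-1}{q-1}$. Then for $r=m+1,\dots,\ell m$, $$\hat d_r\ge q^{\ell+m-r-1}\left(\frac{q^r-1}{q-1}+q^{r-2}-1\right)=\hat d_m+q^{\ell+m-r-1}\left(\frac{q^{r-m}-1}{q-1}+q^{r-2}-1\right).$$ Moreover equality holds when $r=m+1$, so that $\hat d_{m+1}=\hat d_m+q^{\ell+m-3}$.
   Context: $\mathbb{F}_q$ is the finite field with $q$ elements; $X=(X_{ij})$ is an $\ell\times m$ matrix of indeterminates; $\mathbb{F}_q[X]_1$ is the space of linear homogeneous polynomials $f=\sum f_{ij}X_{ij}$ (with $0$), evaluated at a matrix $M$ by $f(M)=\sum f_{ij}M_{ij}$. Let $\hat M_1,\dots,\hat M_{\hat n}$ be representatives, one from each class of nonzero scalar multiples, of the matrices in $M_{\ell\times m}(\mathbb{F}_q)$ of rank exactly $1$; $\hat C_{\det}(1;\ell,m)=\{(f(\hat M_1),\dots,f(\hat M_{\hat n})):f\in\mathbb{F}_q[X]_1\}$. For a code $C$, the support weight of a subcode $D$ is $\|D\|=|\{i:\exists c\in D,\ c_i\neq0\}|$ and $d_r(C)=\min\{\|D\|:D\subseteq C,\ \dim D=r\}$. *)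

theory Defs
  imports "HOL-Analysis.Analysis"
begin

definition support_weight :: "('a::field ^ 'n) set \<Rightarrow> nat" where
  "support_weight D = card {i. \<exists>c\<in>D. c $ i \<noteq> 0}"

(* The value is meaningful only for r \<le> vec.dim C: beyond that Min is taken over the empty set. *)
definition gen_hamming_weight :: "('a::field ^ 'n) set \<Rightarrow> nat \<Rightarrow> nat" where
  "gen_hamming_weight C r =
     Min {support_weight D | D. vec.subspace D \<and> D \<subseteq> C \<and> vec.dim D = r}"

definition mat_scale :: "'a::field \<Rightarrow> 'a ^ 'm ^ 'l \<Rightarrow> 'a ^ 'm ^ 'l" where
  "mat_scale c A = (\<chi> i j. c * A $ i $ j)"

(* A linear homogeneous polynomial in the matrix entries X_ij is given by its coefficient
   matrix f; this is its value at the matrix M. *)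
definition lin_eval :: "'a::field ^ 'm ^ 'l \<Rightarrow> 'a ^ 'm ^ 'l \<Rightarrow> 'a" where
  "lin_eval f M = (\<Sum>i\<in>UNIV. \<Sum>j\<in>UNIV. f $ i $ j * M $ i $ j)"

(* The family M is indexed by a finite type 'n, so that the length of the code is CARD('n). *)
definition rank_one_representatives :: "('n::finite \<Rightarrow> 'a::field ^ 'm ^ 'l) \<Rightarrow> bool" where
  "rank_one_representatives M \<longleftrightarrow>
     (\<forall>k. rank (M k) = 1) \<and>
     (\<forall>A. rank A = 1 \<longrightarrow> (\<exists>!k. \<exists>c. c \<noteq> 0 \<and> A = mat_scale c (M k)))"

definition det_code_hat :: "('n::finite \<Rightarrow> 'a::field ^ 'm ^ 'l) \<Rightarrow> ('a ^ 'n) set" where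
  "det_code_hat M = {(\<chi> k. lin_eval f (M k)) | f. True}"

end

theory Submission
  imports Defs
begin

text \<open>
A subcode \<open>D\<close> of dimension \<open>r\<close> is the image of a space \<open>W\<close> of coefficient matrices with
\<open>q\<^sup>r\<close> elements, and counting pairs (codeword, nonzero coordinate) gives
\<open>(q\<^sup>r - q\<^sup>r\<^sup>-\<^sup>1) \<parallel>D\<parallel> = (\<Sum>f\<in>W. wt f)\<close>. Since \<open>(q - 1) wt f = (q\<^sup>l - |ker f|) q\<^sup>m\<^sup>-\<^sup>1\<close>, where \<open>ker f\<close> is the left
kernel, the weight of a nonzero \<open>f\<close> is at least \<open>q\<^sup>l\<^sup>+\<^sup>m\<^sup>-\<^sup>2\<close>, and at least \<open>q\<^sup>l\<^sup>+\<^sup>m\<^sup>-\<^sup>3 (q + 1)\<close> if its rank is not 1.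
So everything rests on a bound for the number \<open>N\<close> of rank one matrices in \<open>W\<close>, namely
\<open>N \<le> q\<^sup>r\<^sup>-\<^sup>1 + q\<^sup>2 - q - 1\<close> for \<open>r > max l m\<close>.

For \<open>x \<otimes> y \<in> W\<close> let \<open>\<alpha> = |{v. x \<otimes> v \<in> W}|\<close> and \<open>\<beta> = |{u. u \<otimes> y \<in> W}|\<close>. These spaces span a subspace \<open>T\<close> of \<open>W\<close>
with \<open>\<alpha>\<beta>/q\<close> elements, \<open>\<alpha> + \<beta> - q - 1\<close> of rank one. If \<open>s\<close> runs over the other rank one elements of \<open>W\<close>, the
matrices \<open>s + c x \<otimes> y\<close> are distinct and outside \<open>T\<close>, so \<open>N \<le> \<alpha> + \<beta> - q - 1 + q\<^sup>r\<^sup>-\<^sup>1 - \<alpha>\<beta>/q\<^sup>2\<close>,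
which suffices if \<open>(\<alpha> - q\<^sup>2)(\<beta> - q\<^sup>2) \<ge> 0\<close>. If no \<open>x \<otimes> y\<close> is of this kind, one of \<open>\<alpha>, \<beta>\<close> is always \<open>q\<close> and the
other exceeds \<open>q\<^sup>2\<close>. If only one of the two cases occurs, \<open>N < q\<^sup>r\<^sup>-\<^sup>1\<close> because one factor determines the other
up to a scalar. If both occur, the elements of each kind can be translated
by a space of rank one matrices of the other kind without collisions, so each kind has at most \<open>q\<^sup>r\<^sup>-\<^sup>2\<close> members.

The bound for \<open>r = m + 1\<close> is attained by the matrices supported on one row and one further entry.
\<close>

section \<open>Counting in finite groups and vector spaces over a finite field\<close>

lemma card_eq_card_kernel_times_card_image:
  fixes h :: "'a::ab_group_add \<Rightarrow> 'b::ab_group_add"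
  assumes fin: "finite W"
    and diff: "\<And>x y. x \<in> W \<Longrightarrow> y \<in> W \<Longrightarrow> x - y \<in> W"
    and h: "\<And>x y. x \<in> W \<Longrightarrow> y \<in> W \<Longrightarrow> h (x - y) = h x - h y"
  shows "card W = card {x\<in>W. h x = 0} * card (h ` W)"
proof -
  \<comment> \<open>Every fibre is the kernel translated by one of its points. Only closure under
    differences is assumed, so \<open>0\<close> and sums are recovered from it first.\<close>
  have "card {x\<in>W. h x = h a} = card {x\<in>W. h x = 0}" if a: "a \<in> W" for a
  proof (rule bij_betw_same_card)
    have 0: "0 \<in> W" using diff[OF a a] by simp
    have add: "x + a \<in> W" "h (x + a) = h x + h a" if "x \<in> W" for x
    proof -
      have m: "0 - a \<in> W" "h (0 - a) = - h a" using diff[OF 0 a] h[OF 0 a] h[OF 0 0] by auto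
      show "x + a \<in> W" "h (x + a) = h x + h a"
        using diff[OF that m(1)] h[OF that m(1)] m(2) by auto
    qed
    show "bij_betw (\<lambda>x. x - a) {x\<in>W. h x = h a} {x\<in>W. h x = 0}"
      by (rule bij_betwI[where g = "\<lambda>x. x + a"]) (auto simp: diff a h add)
  qed
  then have "(\<Sum>y\<in>h ` W. card {x\<in>W. h x = y}) = (\<Sum>y\<in>h ` W. card {x\<in>W. h x = 0})"
    by (intro sum.cong) auto
  moreover have "card W = (\<Sum>y\<in>h ` W. card {x\<in>W. h x = y})"
    using sum.image_gen[OF fin, of "\<lambda>_. 1::nat" h] by simp
  ultimately show ?thesis by simp
qed

lemma card_field_ge_2: "2 \<le> CARD('a::{field,finite})"
proof -
  have "card {0, 1 :: 'a} \<le> CARD('a)" by (intro card_mono) auto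
  then show ?thesis by simp
qed

text \<open>Each new independent vector multiplies the size by q: an element of the larger span is
  \<open>x + k *s b\<close> for exactly one \<open>k\<close> and one \<open>x\<close> in the old
  span.\<close>

lemma card_span_independent:
  fixes B :: "('a::{field,finite} ^ 'n::finite) set"
  assumes "vec.independent B"
  shows "card (vec.span B) = CARD('a) ^ card B"
proof -
  have "finite B" by simp
  then show ?thesis using assms
  proof (induction B rule: finite_induct)
    case empty
    then show ?case by simp
  next
    case (insert b B)
    have b: "b \<notin> vec.span B" and B: "vec.independent B"
      using insert.prems insert.hyps by (simp_all add: vec.independent_insert)
    have "bij_betw (\<lambda>(k, x). x + k *s b) (UNIV \<times> vec.span B) (vec.span (insert b B))"
      unfolding bij_betw_def
    proof
      show "inj_on (\<lambda>(k, x). x + k *s b) (UNIV \<times> vec.span B)"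
      proof (rule inj_onI, clarsimp)
        fix k x k' x'
        assume x: "x \<in> vec.span B" "x' \<in> vec.span B" and eq: "x + k *s b = x' + k' *s b"
        have d: "(k - k') *s b = x' - x"
          using eq by (simp add: vec.scale_left_diff_distrib algebra_simps)
        have "k = k'"
        proof (rule ccontr)
          assume "k \<noteq> k'"
          then have "b = inverse (k - k') *s (x' - x)" using d
            by (metis right_minus_eq vec.scale_left_imp_eq vec.scale_one vec.scale_scale
                left_inverse)
          then show False using b x by (metis vec.span_diff vec.span_scale)
        qed
        then show "k = k' \<and> x = x'" using eq by simp
      qed
      show "(\<lambda>(k, x). x + k *s b) ` (UNIV \<times> vec.span B) = vec.span (insert b B)"
      proof (auto simp: vec.span_insert image_iff)
        fix x k assume "x - k *s b \<in> vec.span B"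
        then show "\<exists>k. \<exists>y\<in>vec.span B. x = y + k *s b"
          by (intro exI[of _ k] bexI[of _ "x - k *s b"]) auto
      next
        fix k x assume "x \<in> vec.span B"
        then show "\<exists>ka. x + k *s b - ka *s b \<in> vec.span B"
          by (intro exI[of _ k]) auto
      qed
    qed
    from bij_betw_same_card[OF this] show ?case
      using insert B by (simp add: card_cartesian_product)
  qed
qed

lemma card_subspace:
  fixes S :: "('a::{field,finite} ^ 'n::finite) set"
  assumes "vec.subspace S"
  shows "card S = CARD('a) ^ vec.dim S"
proof -
  obtain B where B: "B \<subseteq> S" "vec.independent B" "S \<subseteq> vec.span B" "card B = vec.dim S"
    using vec.basis_exists by blast
  then have "vec.span B = S" using assms by (meson subset_antisym vec.span_minimal)
  then show ?thesis using card_span_independent[OF B(2)] B by simp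
qed

text \<open>The exponent is determined because q is at least 2. Matrix spaces are measured by
  cardinality throughout, and this turns the count for their images in the code into the dimension
  that \<open>gen_hamming_weight\<close> asks for.\<close>

lemma dim_eq_if_card_eq:
  fixes S :: "('a::{field,finite} ^ 'n::finite) set"
  assumes "vec.subspace S" "card S = CARD('a) ^ r"
  shows "vec.dim S = r"
  using assms card_subspace[of S] card_field_ge_2[where 'a='a] power_inject_exp[of "CARD('a)"]
  by (metis One_nat_def Suc_1 Suc_le_lessD)

section \<open>Linear functionals, coordinates and the double count of weights\<close>

definition dot :: "'a::field ^ 'n \<Rightarrow> 'a ^ 'n \<Rightarrow> 'a" where
  "dot w v = (\<Sum>j\<in>UNIV. w $ j * v $ j)"

text \<open>A nonzero functional attains every value, already on the multiples of one unit vector,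
  so its kernel is a fraction 1/q of the space.\<close>

lemma card_dot_neq_0:
  fixes w :: "'a::{field,finite} ^ 'n::finite"
  assumes "w \<noteq> 0"
  shows "CARD('a) * card {v. dot w v \<noteq> 0} = (CARD('a) - 1) * CARD('a) ^ CARD('n)"
proof -
  obtain j where j: "w $ j \<noteq> 0" using assms by (auto simp: vec_eq_iff)
  have d: "dot w (axis j (c / w $ j)) = c" for c
    using j by (simp add: dot_def axis_def if_distrib cong: if_cong)
  have r: "dot w ` UNIV = UNIV" using d by (metis surj_def)
  have *: "CARD('a) ^ CARD('n) = card {v. dot w v = 0} * CARD('a)"
    using card_eq_card_kernel_times_card_image[of UNIV "dot w"]
    by (simp add: r) (simp add: dot_def algebra_simps sum_subtractf)
  have "{v. dot w v \<noteq> 0} = UNIV - {v. dot w v = 0}" by auto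
  then have "card {v. dot w v \<noteq> 0} = CARD('a) ^ CARD('n) - card {v. dot w v = 0}"
    by (simp add: card_Diff_subset)
  then show ?thesis using * by (simp add: diff_mult_distrib diff_mult_distrib2 mult.commute)
qed

lemma card_nonzero_coordinate:
  fixes D :: "('a::{field,finite} ^ 'n::finite) set"
  assumes D: "vec.subspace D" and c: "c \<in> D" "c $ k \<noteq> 0"
  shows "CARD('a) * card {c\<in>D. c $ k \<noteq> 0} = (CARD('a) - 1) * card D"
proof -
  have "a \<in> (\<lambda>c. c $ k) ` D" for a
    by (rule image_eqI[of _ _ "(a / c $ k) *s c"]) (use c D in \<open>auto intro: vec.subspace_scale\<close>)
  then have r: "(\<lambda>c. c $ k) ` D = UNIV" by auto
  have 1: "card D = card {x\<in>D. x $ k = 0} * CARD('a)"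
    using card_eq_card_kernel_times_card_image[of D "\<lambda>c. c $ k"] D
    by (simp add: r vec.subspace_diff)
  have "{c\<in>D. c $ k \<noteq> 0} = D - {x\<in>D. x $ k = 0}" by auto
  then have "card {c\<in>D. c $ k \<noteq> 0} = card D - card {x\<in>D. x $ k = 0}"
    by (simp add: card_Diff_subset)
  then show ?thesis using 1 by (simp add: diff_mult_distrib diff_mult_distrib2 mult.commute)
qed

text \<open>Pairs of a codeword and a coordinate where it is nonzero are counted in two ways: a
  coordinate in the support is nonzero on exactly a fraction (q - 1)/q of \<open>D\<close>, any
  other one nowhere. The factor q on the left clears the division.\<close>

lemma sum_weight_eq:
  fixes D :: "('a::{field,finite} ^ 'n::finite) set"
  assumes D: "vec.subspace D"
  shows "CARD('a) * (\<Sum>c\<in>D. card {k. c $ k \<noteq> 0}) = (CARD('a) - 1) * card D * support_weight D"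
proof -
  let ?S = "{k. \<exists>c\<in>D. c $ k \<noteq> 0}"
  have *: "CARD('a) * card {c\<in>D. c $ k \<noteq> 0} = (CARD('a) - 1) * card D" if k: "k \<in> ?S" for k
  proof -
    obtain c where "c \<in> D" "c $ k \<noteq> 0" using k by blast
    then show ?thesis by (rule card_nonzero_coordinate[OF D])
  qed
  have "(\<Sum>c\<in>D. card {k. c $ k \<noteq> 0}) = (\<Sum>c\<in>D. \<Sum>k\<in>UNIV. if c $ k \<noteq> 0 then 1 else 0)"
    by (simp add: sum.If_cases)
  also have "\<dots> = (\<Sum>k\<in>UNIV. \<Sum>c\<in>D. if c $ k \<noteq> 0 then 1 else 0)" by (rule sum.swap)
  also have "\<dots> = (\<Sum>k\<in>UNIV. card {c\<in>D. c $ k \<noteq> 0})"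
    by (auto simp: sum.If_cases intro!: sum.cong arg_cong[where f = card])
  also have "\<dots> = (\<Sum>k\<in>?S. card {c\<in>D. c $ k \<noteq> 0})"
    by (rule sum.mono_neutral_right) auto
  finally have "CARD('a) * (\<Sum>c\<in>D. card {k. c $ k \<noteq> 0}) =
      (\<Sum>k\<in>?S. CARD('a) * card {c\<in>D. c $ k \<noteq> 0})" by (simp add: sum_distrib_left)
  also have "\<dots> = (\<Sum>k\<in>?S. (CARD('a) - 1) * card D)" using * by (intro sum.cong) auto
  finally show ?thesis by (simp add: support_weight_def mult.commute)
qed

section \<open>Rank one matrices as outer products\<close>

definition outer :: "'a::field ^ 'l \<Rightarrow> 'a ^ 'm \<Rightarrow> 'a ^ 'm ^ 'l" where
  "outer u v = (\<chi> i j. u $ i * v $ j)"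

lemma outer_nth [simp]: "outer u v $ i $ j = u $ i * v $ j"
  by (simp add: outer_def)

lemma mat_scale_nth [simp]: "mat_scale c A $ i $ j = c * A $ i $ j"
  by (simp add: mat_scale_def)

lemma matrix_eq_iff: "A = B \<longleftrightarrow> (\<forall>i j. A $ i $ j = B $ i $ j)"
  by (simp add: vec_eq_iff)

lemma outer_eq_0_iff [simp]: "outer u v = 0 \<longleftrightarrow> u = 0 \<or> v = 0"
  by (auto simp: vec_eq_iff)

lemma outer_scale_left: "outer (c *s u) v = mat_scale c (outer u v)"
  and outer_scale_right: "outer u (c *s v) = mat_scale c (outer u v)"
  by (simp_all add: matrix_eq_iff)

lemma outer_diff_left: "outer (u - u') v = outer u v - outer u' v"
  and outer_diff_right: "outer u (v - v') = outer u v - outer u v'"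
  and outer_add_left: "outer (u + u') v = outer u v + outer u' v"
  and outer_add_right: "outer u (v + v') = outer u v + outer u v'"
  by (simp_all add: matrix_eq_iff algebra_simps)

lemma mat_scale_mat_scale [simp]: "mat_scale a (mat_scale b A) = mat_scale (a * b) A"
  and mat_scale_1 [simp]: "mat_scale 1 A = A"
  by (simp_all add: matrix_eq_iff mult.assoc)

lemma transpose_outer: "transpose (outer u v) = outer v u"
  by (simp add: matrix_eq_iff transpose_def mult.commute)

text \<open>Comparing entries along a row where \<open>u'\<close> is nonzero makes \<open>v'\<close>
  a multiple of \<open>v\<close>; a column where \<open>v'\<close> is nonzero then gives the
  relation of the left factors with the same scalar.\<close>

lemma outer_eq_outerE:
  assumes eq: "outer u v = outer u' v'" and nz: "u' \<noteq> 0" "v' \<noteq> 0"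
  obtains c where "c \<noteq> 0" "u = c *s u'" "v' = c *s v"
proof -
  obtain i where i: "u' $ i \<noteq> 0" using nz by (auto simp: vec_eq_iff)
  obtain j where j: "v' $ j \<noteq> 0" using nz by (auto simp: vec_eq_iff)
  have e: "u $ a * v $ b = u' $ a * v' $ b" for a b
    using eq by (simp add: matrix_eq_iff)
  define c where "c = u $ i / u' $ i"
  have v': "v' = c *s v" using e[of i] i by (simp add: vec_eq_iff c_def field_simps)
  then have c: "c \<noteq> 0" "v $ j \<noteq> 0" using j by auto
  have "u $ a = c * u' $ a" for a
    using e[of a j] c v' by simp
  then have "u = c *s u'" by (simp add: vec_eq_iff)
  then show ?thesis using that c v' by blast
qed

lemma proportionalI:
  fixes u x :: "'a::field ^ 'n"
  assumes "\<forall>i k. u $ i * x $ k = u $ k * x $ i" "x \<noteq> 0"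
  shows "\<exists>c. u = c *s x"
proof -
  obtain k where "x $ k \<noteq> 0" using assms by (auto simp: vec_eq_iff)
  then have "u = (u $ k / x $ k) *s x" using assms(1) by (simp add: vec_eq_iff field_simps)
  then show ?thesis by blast
qed

text \<open>The two-by-two minors of \<open>outer u v + outer x y\<close> are the products of those
  of the pairs \<open>u, x\<close> and \<open>v, y\<close>.\<close>

lemma outer_add_eq_outerD:
  assumes "outer u v + outer x y = outer a b"
  shows "(\<forall>i k. u $ i * x $ k = u $ k * x $ i) \<or> (\<forall>j n. v $ j * y $ n = v $ n * y $ j)"
proof (rule ccontr)
  assume "\<not> ?thesis"
  then obtain i k j n where ne: "u $ i * x $ k - u $ k * x $ i \<noteq> 0" "v $ j * y $ n - v $ n * y $ j \<noteq> 0"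
    by auto
  have e: "u $ i * v $ j + x $ i * y $ j = a $ i * b $ j" for i j
    using assms by (simp add: matrix_eq_iff)
  have "(u $ i * x $ k - u $ k * x $ i) * (v $ j * y $ n - v $ n * y $ j) =
      (u $ i * v $ j + x $ i * y $ j) * (u $ k * v $ n + x $ k * y $ n) -
      (u $ i * v $ n + x $ i * y $ n) * (u $ k * v $ j + x $ k * y $ j)"
    by (simp add: algebra_simps)
  also have "\<dots> = 0" by (simp add: e)
  finally show False using ne by simp
qed

lemma rank_eq_1_iff:
  fixes A :: "'a::field ^ 'm::finite ^ 'l::finite"
  shows "rank A = 1 \<longleftrightarrow> (\<exists>u v. u \<noteq> 0 \<and> v \<noteq> 0 \<and> A = outer u v)"
proof
  assume "rank A = 1"
  then obtain B where B: "B \<subseteq> rows A" "vec.independent B" "rows A \<subseteq> vec.span B" "card B = 1"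
    unfolding row_rank_def_gen using vec.basis_exists[of "rows A"] by auto
  then obtain v where v: "B = {v}" by (auto simp: card_1_singleton_iff)
  have rA: "row i A = A $ i" for i by (simp add: row_def vec_nth_inverse)
  have "\<exists>c. A $ i = c *s v" for i
  proof -
    have "A $ i \<in> rows A" unfolding rows_def rA by blast
    then show ?thesis using B(3) v by (auto simp: vec.span_singleton)
  qed
  then obtain c where c: "A $ i = c i *s v" for i by metis
  have A: "A = outer (vec_lambda c) v" by (simp add: matrix_eq_iff c)
  have v0: "v \<noteq> 0" using B(2) v vec.dependent_zero by blast
  obtain i where "v = A $ i" using B(1) v unfolding rows_def rA by blast
  then have "A \<noteq> 0" using v0 by auto
  then have "vec_lambda c \<noteq> 0" using A outer_eq_0_iff[of "vec_lambda c" v] by simp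
  then show "\<exists>u v. u \<noteq> 0 \<and> v \<noteq> 0 \<and> A = outer u v" using A v0 by blast
next
  assume "\<exists>u v. u \<noteq> 0 \<and> v \<noteq> 0 \<and> A = outer u v"
  then obtain u v where uv: "u \<noteq> 0" "v \<noteq> 0" "A = outer u v" by blast
  have r: "rows A = {u $ i *s v | i. True}"
    unfolding uv rows_def row_def by (auto simp: vec_eq_iff)
  obtain i where i: "u $ i \<noteq> 0" using uv by (auto simp: vec_eq_iff)
  have "u $ i *s v \<in> vec.span (rows A)" using r by (auto intro: vec.span_base)
  then have "inverse (u $ i) *s (u $ i *s v) \<in> vec.span (rows A)" by (rule vec.span_scale)
  then have "v \<in> vec.span (rows A)" using i by simp
  moreover have "rows A \<subseteq> vec.span {v}" using r by (auto simp: vec.span_singleton)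
  ultimately have "vec.span (rows A) = vec.span {v}"
    by (intro subset_antisym vec.span_minimal) auto
  then have "vec.dim (rows A) = vec.dim {v}" using vec.dim_span[of "rows A"] vec.dim_span[of "{v}"] by simp
  then show "rank A = 1" using uv by (simp add: row_rank_def_gen)
qed

section \<open>Evaluation at rank one matrices and the weight of a single codeword\<close>

lemma lin_eval_outer: "lin_eval f (outer u v) = dot (u v* f) v"
proof -
  have "lin_eval f (outer u v) = (\<Sum>j\<in>UNIV. \<Sum>i\<in>UNIV. f $ i $ j * (u $ i * v $ j))"
    unfolding lin_eval_def by (subst sum.swap) simp
  also have "\<dots> = dot (u v* f) v"
    by (simp add: dot_def vector_matrix_mult_def sum_distrib_left mult_ac)
  finally show ?thesis .
qed

lemma lin_eval_diff: "lin_eval (f - g) A = lin_eval f A - lin_eval g A"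
  and lin_eval_add: "lin_eval (f + g) A = lin_eval f A + lin_eval g A"
  and lin_eval_scale_left: "lin_eval (mat_scale c f) A = c * lin_eval f A"
  and lin_eval_scale_right: "lin_eval f (mat_scale c A) = c * lin_eval f A"
  by (simp_all add: lin_eval_def left_diff_distrib distrib_right mult.left_commute mult.assoc
      sum_subtractf sum.distrib sum_distrib_left)

text \<open>A rank one matrix and its nonzero multiples have (q - 1)^2 factorisations in total,
  obtained by scaling the two factors independently. Invariance under scaling makes \<open>Q\<close>
  a property of classes. This replaces counts over the representatives by counts of pairs of
  vectors.\<close>

lemma card_rank_one_pairs:
  fixes M :: "'n::finite \<Rightarrow> 'a::{field,finite} ^ 'm::finite ^ 'l::finite"
  assumes M: "rank_one_representatives M"
    and Q: "\<And>c A. c \<noteq> 0 \<Longrightarrow> Q (mat_scale c A) \<longleftrightarrow> Q A"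
  shows "card {(u, v). u \<noteq> 0 \<and> v \<noteq> 0 \<and> Q (outer u v)} = (CARD('a) - 1)\<^sup>2 * card {k. Q (M k)}"
proof -
  define P where "P k = {(u, v). u \<noteq> 0 \<and> v \<noteq> 0 \<and> (\<exists>c. c \<noteq> 0 \<and> outer u v = mat_scale c (M k))}" for k
  have M1: "\<exists>u v. u \<noteq> 0 \<and> v \<noteq> 0 \<and> M k = outer u v" for k
    using M unfolding rank_one_representatives_def rank_eq_1_iff by blast
  have ex: "\<exists>!k. \<exists>c. c \<noteq> 0 \<and> outer u v = mat_scale c (M k)" if "u \<noteq> 0" "v \<noteq> 0" for u v
  proof -
    have "rank (outer u v) = 1" unfolding rank_eq_1_iff using that by blast
    then show ?thesis using M unfolding rank_one_representatives_def by blast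
  qed
  have unique: "i = j" if "u \<noteq> 0" "v \<noteq> 0" "\<exists>c. c \<noteq> 0 \<and> outer u v = mat_scale c (M i)"
    "\<exists>c. c \<noteq> 0 \<and> outer u v = mat_scale c (M j)" for u v i j
    using ex[OF that(1,2)] that(3,4) by (elim ex1E) blast
  have cP: "card (P k) = (CARD('a) - 1)\<^sup>2" for k
  proof -
    obtain a b where ab: "a \<noteq> 0" "b \<noteq> 0" "M k = outer a b" using M1 by blast
    have "bij_betw (\<lambda>(s, t). (s *s a, t *s b)) ((UNIV - {0}) \<times> (UNIV - {0})) (P k)"
      unfolding bij_betw_def
    proof
      show "inj_on (\<lambda>(s, t). (s *s a, t *s b)) ((UNIV - {0}) \<times> (UNIV - {0}))"
        using ab by (auto intro!: inj_onI)
      show "(\<lambda>(s, t). (s *s a, t *s b)) ` ((UNIV - {0}) \<times> (UNIV - {0})) = P k"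
      proof
        show "(\<lambda>(s, t). (s *s a, t *s b)) ` ((UNIV - {0}) \<times> (UNIV - {0})) \<subseteq> P k"
        proof
          fix p assume "p \<in> (\<lambda>(s, t). (s *s a, t *s b)) ` ((UNIV - {0}) \<times> (UNIV - {0}))"
          then obtain s t where "s \<noteq> 0" "t \<noteq> 0" "p = (s *s a, t *s b)" by auto
          moreover from this have "outer (s *s a) (t *s b) = mat_scale (s * t) (M k)"
            by (simp add: ab outer_scale_left outer_scale_right mult.commute)
          moreover have "s * t \<noteq> 0" using \<open>s \<noteq> 0\<close> \<open>t \<noteq> 0\<close> by simp
          ultimately have "\<exists>c. c \<noteq> 0 \<and> outer (s *s a) (t *s b) = mat_scale c (M k)" by blast
          then show "p \<in> P k" using ab(1,2) \<open>s \<noteq> 0\<close> \<open>t \<noteq> 0\<close> \<open>p = _\<close> by (simp add: P_def)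
        qed
        show "P k \<subseteq> (\<lambda>(s, t). (s *s a, t *s b)) ` ((UNIV - {0}) \<times> (UNIV - {0}))"
        proof (clarsimp simp: P_def)
          fix u :: "'a ^ 'l" and v :: "'a ^ 'm" and c
          assume uv: "u \<noteq> 0" "v \<noteq> 0" "c \<noteq> 0" "outer u v = mat_scale c (M k)"
          then have "outer a (c *s b) = outer u v" using ab by (simp add: outer_scale_right)
          then obtain d where d: "d \<noteq> 0" "a = d *s u" "v = d *s (c *s b)"
            using uv by (metis outer_eq_outerE)
          have "inverse d *s a = u" using d(1) by (simp add: d(2))
          moreover have "(d * c) *s b = v" by (simp add: d(3))
          ultimately have "(u, v) = (\<lambda>(s, t). (s *s a, t *s b)) (inverse d, d * c)" by simp
          moreover have "(inverse d, d * c) \<in> (UNIV - {0}) \<times> (UNIV - {0})" using d(1) uv(3) by simp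
          ultimately show "(u, v) \<in> (\<lambda>(s, t). (s *s a, t *s b)) ` ((UNIV - {0}) \<times> (UNIV - {0}))"
            by (rule image_eqI)
        qed
      qed
    qed
    from bij_betw_same_card[OF this] show ?thesis
      by (simp add: card_cartesian_product power2_eq_square card_Diff_subset)
  qed
  \<comment> \<open>The sets \<open>P k\<close> are disjoint and cover all pairs of nonzero vectors,
    as each outer product lies in exactly one class; \<open>Q\<close> selects whole sets.\<close>
  have "{(u, v). u \<noteq> 0 \<and> v \<noteq> 0 \<and> Q (outer u v)} = (\<Union>k\<in>{k. Q (M k)}. P k)"
  proof -
    have "Q (outer u v) \<longleftrightarrow> (\<exists>k. Q (M k) \<and> (\<exists>c. c \<noteq> 0 \<and> outer u v = mat_scale c (M k)))"
      if nz: "u \<noteq> 0" "v \<noteq> 0" for u v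
    proof
      assume "Q (outer u v)"
      moreover obtain k c where kc: "c \<noteq> 0" "outer u v = mat_scale c (M k)"
        using ex1_implies_ex[OF ex[OF nz]] by blast
      ultimately have "Q (M k)" using Q[of c "M k"] by simp
      then show "\<exists>k. Q (M k) \<and> (\<exists>c. c \<noteq> 0 \<and> outer u v = mat_scale c (M k))" using kc by blast
    next
      assume "\<exists>k. Q (M k) \<and> (\<exists>c. c \<noteq> 0 \<and> outer u v = mat_scale c (M k))"
      then obtain k c where "Q (M k)" "c \<noteq> 0" "outer u v = mat_scale c (M k)" by blast
      then show "Q (outer u v)" using Q[of c "M k"] by simp
    qed
    then have "p \<in> {(u, v). u \<noteq> 0 \<and> v \<noteq> 0 \<and> Q (outer u v)} \<longleftrightarrow> p \<in> (\<Union>k\<in>{k. Q (M k)}. P k)" for p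
      by (cases p) (simp add: P_def cong: conj_cong)
    then show ?thesis by (rule set_eqI)
  qed
  moreover have "card (\<Union>k\<in>{k. Q (M k)}. P k) = (\<Sum>k\<in>{k. Q (M k)}. card (P k))"
  proof (rule card_UN_disjoint)
    show "\<forall>i\<in>{k. Q (M k)}. \<forall>j\<in>{k. Q (M k)}. i \<noteq> j \<longrightarrow> P i \<inter> P j = {}"
    proof (intro ballI impI equals0I)
      fix i j p assume "i \<noteq> j" and p: "p \<in> P i \<inter> P j"
      obtain u v where "p = (u, v)" by (cases p)
      then have "u \<noteq> 0" "v \<noteq> 0" "\<exists>c. c \<noteq> 0 \<and> outer u v = mat_scale c (M i)"
        "\<exists>c. c \<noteq> 0 \<and> outer u v = mat_scale c (M j)" using p by (simp_all add: P_def)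
      then show False using unique[of u v i j] \<open>i \<noteq> j\<close> by blast
    qed
  qed simp_all
  ultimately show ?thesis by (simp add: cP)
qed

text \<open>For \<open>u\<close> outside the left kernel, \<open>v\<close> enters through a nonzero
  functional, which is nonzero on (q - 1) q^(m-1) vectors; for \<open>u\<close> in the kernel it
  vanishes. Summing over \<open>u\<close> counts each nonzero coordinate (q - 1)^2 times. The kernel
  term stands on the left to avoid subtraction of naturals.\<close>

lemma kernel_times_weight:
  fixes M :: "'n::finite \<Rightarrow> 'a::{field,finite} ^ 'm::finite ^ 'l::finite"
  assumes M: "rank_one_representatives M"
  shows "CARD('a) * (CARD('a) - 1) * card {k. lin_eval f (M k) \<noteq> 0} + card {u. u v* f = 0} * CARD('a) ^ CARD('m)
    = CARD('a) ^ CARD('l) * CARD('a) ^ CARD('m)"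
proof -
  define q where "q = CARD('a)"
  define K where "K = {u. u v* f = 0}"
  define w where "w = card {k. lin_eval f (M k) \<noteq> 0}"
  have q: "2 \<le> q" unfolding q_def by (rule card_field_ge_2)
  have dot0: "dot 0 v = 0" "dot w 0 = 0" for v w :: "'a ^ 'm" by (simp_all add: dot_def)
  have "0 v* f = 0" by (simp add: vector_matrix_mult_def vec_eq_iff)
  then have "u \<noteq> 0 \<and> v \<noteq> 0 \<and> lin_eval f (outer u v) \<noteq> 0 \<longleftrightarrow> u \<notin> K \<and> dot (u v* f) v \<noteq> 0" for u v
    unfolding lin_eval_outer K_def using dot0 by (metis mem_Collect_eq)
  then have "{(u, v). u \<noteq> 0 \<and> v \<noteq> 0 \<and> lin_eval f (outer u v) \<noteq> 0} = (SIGMA u:UNIV - K. {v. dot (u v* f) v \<noteq> 0})"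
    by blast
  moreover have "card {(u, v). u \<noteq> 0 \<and> v \<noteq> 0 \<and> lin_eval f (outer u v) \<noteq> 0} = (q - 1)\<^sup>2 * w"
    unfolding q_def w_def by (rule card_rank_one_pairs[OF M]) (simp add: lin_eval_scale_right)
  moreover have "card (SIGMA u:UNIV - K. {v. dot (u v* f) v \<noteq> 0}) = (\<Sum>u\<in>UNIV - K. card {v. dot (u v* f) v \<noteq> 0})"
    by (rule card_SigmaI) simp_all
  ultimately have "q * ((q - 1)\<^sup>2 * w) = (\<Sum>u\<in>UNIV - K. q * card {v. dot (u v* f) v \<noteq> 0})"
    unfolding sum_distrib_left[symmetric] by argo
  also have "\<dots> = (\<Sum>u\<in>UNIV - K. (q - 1) * q ^ CARD('m))"
    unfolding q_def by (intro sum.cong refl card_dot_neq_0) (simp add: K_def)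
  also have "\<dots> = (q - 1) * (card (UNIV - K) * q ^ CARD('m))" by simp
  finally have "(q - 1) * (q * (q - 1) * w) = (q - 1) * (card (UNIV - K) * q ^ CARD('m))"
    by (simp only: power2_eq_square mult.assoc mult.left_commute)
  then have "q * (q - 1) * w = card (UNIV - K) * q ^ CARD('m)"
    using q by (simp only: mult_cancel1) linarith
  moreover have "card (UNIV - K) + card K = q ^ CARD('l)"
    using card_Diff_subset[of K UNIV] card_mono[of UNIV K] by (simp add: q_def)
  ultimately show ?thesis unfolding q_def[symmetric] K_def[symmetric] w_def[symmetric]
    by (metis distrib_right)
qed

text \<open>The image of \<open>\<lambda>u. u v* f\<close> is the row space of \<open>f\<close>, so
  the left kernel shrinks and the weight grows with the rank. Rank at least 1 gives the first bound.
  A row space of dimension 1 makes \<open>f\<close> an outer product, so otherwise the rank is at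
  least 2, which gives the second.\<close>

lemma weight_bounds:
  fixes M :: "'n::finite \<Rightarrow> 'a::{field,finite} ^ 'm::finite ^ 'l::finite"
  assumes M: "rank_one_representatives M" and f: "f \<noteq> 0"
  shows weight_ge: "CARD('a) ^ (CARD('l) + CARD('m)) \<le> CARD('a)\<^sup>2 * card {k. lin_eval f (M k) \<noteq> 0}"
    and weight_ge_if_not_outer: "(\<And>u v. f \<noteq> outer u v) \<Longrightarrow>
      (CARD('a) + 1) * CARD('a) ^ (CARD('l) + CARD('m)) \<le> CARD('a) ^ 3 * card {k. lin_eval f (M k) \<noteq> 0}"
proof -
  let ?q = "CARD('a)"
  let ?w = "card {k. lin_eval f (M k) \<noteq> 0}"
  let ?K = "card {u. u v* f = 0}"
  let ?R = "range (\<lambda>u. u v* f)"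
  have q: "2 \<le> ?q" by (rule card_field_ge_2)
  have KR: "?q ^ CARD('l) = ?K * card ?R"
    using card_eq_card_kernel_times_card_image[of UNIV "\<lambda>u. u v* f"]
    by (simp add: vector_matrix_mult_def vec_eq_iff algebra_simps sum_subtractf)
  have sub: "vec.subspace ?R"
  proof (rule vec.subspaceI)
    have "0 v* f = 0" by (simp add: vector_matrix_mult_def vec_eq_iff)
    then show "0 \<in> ?R" by (metis rangeI)
    fix x y c assume "x \<in> ?R" "y \<in> ?R"
    then obtain u v where uv: "x = u v* f" "y = v v* f" by auto
    have "x + y = (u + v) v* f" "c *s x = (c *s u) v* f"
      by (simp_all add: uv vector_matrix_mult_def vec_eq_iff algebra_simps sum.distrib sum_distrib_left)
    then show "x + y \<in> ?R" "c *s x \<in> ?R" by blast+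
  qed
  have row: "axis i 1 v* f = f $ i" for i
    by (simp add: vector_matrix_mult_def vec_eq_iff axis_def if_distrib[where f = "\<lambda>x. x * y" for y] cong: if_cong)
  have d0: "vec.dim ?R \<noteq> 0"
  proof
    assume "vec.dim ?R = 0"
    then have "axis i 1 v* f = 0" for i by auto
    then show False using f row by (simp add: vec_eq_iff)
  qed
  have d1: "\<exists>u v. f = outer u v" if d: "vec.dim ?R = 1"
  proof -
    obtain B where B: "vec.independent B" "?R \<subseteq> vec.span B" "card B = 1"
      using vec.basis_exists[of ?R] d by metis
    then obtain v where v: "B = {v}" by (auto simp: card_1_singleton_iff)
    have "\<exists>c. f $ i = c *s v" for i
    proof -
      have "f $ i \<in> ?R" by (metis row rangeI)
      then show ?thesis using B(2) v by (auto simp: vec.span_singleton)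
    qed
    then obtain c where c: "f $ i = c i *s v" for i by metis
    have "f = outer (vec_lambda c) v" by (simp add: matrix_eq_iff c)
    then show ?thesis by blast
  qed
  have w: "?q * (?q - 1) * ?w + ?K * ?q ^ CARD('m) = ?q ^ (CARD('l) + CARD('m))"
    using kernel_times_weight[OF M, of f] by (simp add: power_add)
  have R: "card ?R = ?q ^ vec.dim ?R" using card_subspace[OF sub] .
  \<comment> \<open>A row space of dimension at least \<open>n\<close> leaves a kernel of at most
    q^(l-n) elements; the factor \<open>?q ^ n\<close> clears this quotient.\<close>
  have main: "(?q ^ n - 1) * ?q ^ (CARD('l) + CARD('m)) \<le> ?q ^ n * (?q * (?q - 1) * ?w)"
    if "n \<le> vec.dim ?R" for n
  proof -
    have "?q ^ n \<le> card ?R" using q that unfolding R by (intro power_increasing) auto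
    then have "?q ^ n * ?K \<le> ?q ^ CARD('l)" unfolding KR by simp
    then have *: "?q ^ n * (?K * ?q ^ CARD('m)) \<le> ?q ^ (CARD('l) + CARD('m))"
      by (simp add: power_add flip: mult.assoc)
    have "?q ^ n * ?q ^ (CARD('l) + CARD('m)) = ?q ^ n * (?q * (?q - 1) * ?w) + ?q ^ n * (?K * ?q ^ CARD('m))"
      unfolding w[symmetric] by (simp only: distrib_left)
    then have "?q ^ n * ?q ^ (CARD('l) + CARD('m)) \<le> ?q ^ n * (?q * (?q - 1) * ?w) + ?q ^ (CARD('l) + CARD('m))"
      using * by linarith
    then show ?thesis unfolding diff_mult_distrib by simp
  qed
  have "(?q - 1) * ?q ^ (CARD('l) + CARD('m)) \<le> (?q - 1) * (?q\<^sup>2 * ?w)"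
    using main[of 1] d0 by (simp add: power2_eq_square mult.assoc mult.left_commute)
  then show "?q ^ (CARD('l) + CARD('m)) \<le> ?q\<^sup>2 * ?w" using q by simp
  assume "\<And>u v. f \<noteq> outer u v"
  then have "2 \<le> vec.dim ?R" using d0 d1 by fastforce
  then have "(?q - 1) * ((?q + 1) * ?q ^ (CARD('l) + CARD('m))) \<le> (?q - 1) * (?q ^ 3 * ?w)"
  proof -
    have "?q\<^sup>2 - 1 = (?q - 1) * (?q + 1)" by (simp add: power2_eq_square algebra_simps)
    moreover have "?q\<^sup>2 * (?q * (?q - 1) * ?w) = (?q - 1) * (?q ^ 3 * ?w)"
      by (simp add: power2_eq_square power3_eq_cube)
    ultimately show ?thesis using main[OF \<open>2 \<le> vec.dim ?R\<close>] by (metis mult.assoc)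
  qed
  then show "(?q + 1) * ?q ^ (CARD('l) + CARD('m)) \<le> ?q ^ 3 * ?w" using q by simp
qed

section \<open>Matrix spaces and the number of their rank one elements\<close>

definition mat_subspace :: "('a::field ^ 'm ^ 'l) set \<Rightarrow> bool" where
  "mat_subspace W \<longleftrightarrow> 0 \<in> W \<and> (\<forall>A\<in>W. \<forall>B\<in>W. A + B \<in> W) \<and> (\<forall>c. \<forall>A\<in>W. mat_scale c A \<in> W)"

lemma mat_subspace_0: "mat_subspace W \<Longrightarrow> 0 \<in> W"
  and mat_subspace_add: "mat_subspace W \<Longrightarrow> A \<in> W \<Longrightarrow> B \<in> W \<Longrightarrow> A + B \<in> W"
  and mat_subspace_scale: "mat_subspace W \<Longrightarrow> A \<in> W \<Longrightarrow> mat_scale c A \<in> W"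
  by (simp_all add: mat_subspace_def)

definition rank_one_elements :: "('a::field ^ 'm ^ 'l) set \<Rightarrow> ('a ^ 'm ^ 'l) set" where
  "rank_one_elements W = {A\<in>W. \<exists>u v. u \<noteq> 0 \<and> v \<noteq> 0 \<and> A = outer u v}"

definition right_factors :: "('a::field ^ 'm ^ 'l) set \<Rightarrow> 'a ^ 'l \<Rightarrow> ('a ^ 'm) set" where
  "right_factors W x = {v. outer x v \<in> W}"

definition left_factors :: "('a::field ^ 'm ^ 'l) set \<Rightarrow> 'a ^ 'm \<Rightarrow> ('a ^ 'l) set" where
  "left_factors W y = {u. outer u y \<in> W}"

lemma outer_0 [simp]: "outer x 0 = 0" "outer 0 y = 0"
  by simp_all

lemma subspace_right_factors: "mat_subspace W \<Longrightarrow> vec.subspace (right_factors W x)"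
  and subspace_left_factors: "mat_subspace W \<Longrightarrow> vec.subspace (left_factors W y)"
  by (auto intro!: vec.subspaceI simp: right_factors_def left_factors_def outer_add_left
      outer_add_right outer_scale_left outer_scale_right mat_subspace_0 mat_subspace_add mat_subspace_scale)

lemma mat_scale_mem_iff:
  assumes "mat_subspace W" "c \<noteq> 0"
  shows "mat_scale c A \<in> W \<longleftrightarrow> A \<in> W"
  using mat_subspace_scale[OF assms(1), of A c] mat_subspace_scale[OF assms(1), of "mat_scale c A" "inverse c"] assms(2)
  by auto

lemma right_factors_scale:
  "mat_subspace W \<Longrightarrow> c \<noteq> 0 \<Longrightarrow> right_factors W (c *s x) = right_factors W x"
  and left_factors_scale:
  "mat_subspace W \<Longrightarrow> c \<noteq> 0 \<Longrightarrow> left_factors W (c *s y) = left_factors W y"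
  by (simp_all add: right_factors_def left_factors_def outer_scale_left outer_scale_right mat_scale_mem_iff)

lemma transpose_transpose_image: "transpose ` transpose ` W = W"
  by (simp add: image_image)

lemma transpose_mem_image: "transpose A \<in> transpose ` W \<longleftrightarrow> A \<in> W"
  by (metis image_iff transpose_transpose)

text \<open>Transposition exchanges left and right factors and preserves cardinalities and rank one
  elements, so a bound proved for one side carries over to the other.\<close>

lemma mat_subspace_transpose:
  fixes W :: "('a::field ^ 'l ^ 'm) set"
  assumes "mat_subspace W"
  shows "mat_subspace (transpose ` W)"
proof -
  have 0: "transpose 0 = (0 :: 'a ^ 'm ^ 'l)"
    and add: "transpose A + transpose B = transpose (A + B)"
    and scale: "mat_scale c (transpose A) = transpose (mat_scale c A)" for A B :: "'a ^ 'l ^ 'm" and c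
    by (simp_all add: matrix_eq_iff transpose_def)
  have "0 \<in> transpose ` W" by (rule image_eqI[OF _ mat_subspace_0[OF assms]]) (simp add: 0)
  moreover have "transpose A + transpose B \<in> transpose ` W" "mat_scale c (transpose A) \<in> transpose ` W"
    if "A \<in> W" "B \<in> W" for A B c
    using that unfolding add scale
    by (simp_all add: transpose_mem_image mat_subspace_add[OF assms] mat_subspace_scale[OF assms])
  ultimately show ?thesis unfolding mat_subspace_def by blast
qed

lemma outer_mem_transpose_image: "outer u v \<in> transpose ` W \<longleftrightarrow> outer v u \<in> W"
  using transpose_mem_image[of "outer v u" W] by (simp add: transpose_outer)

lemma left_factors_transpose: "left_factors (transpose ` W) x = right_factors W x"
  and right_factors_transpose: "right_factors (transpose ` W) y = left_factors W y"
  by (simp_all add: left_factors_def right_factors_def outer_mem_transpose_image)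

lemma transpose_rank_one_elements_subset:
  "transpose ` rank_one_elements W \<subseteq> rank_one_elements (transpose ` W)"
proof
  fix A assume "A \<in> transpose ` rank_one_elements W"
  then obtain u v where "u \<noteq> 0" "v \<noteq> 0" "outer u v \<in> W" "A = outer v u"
    by (auto simp: rank_one_elements_def transpose_outer)
  moreover from this have "A \<in> transpose ` W" by (simp add: outer_mem_transpose_image)
  ultimately show "A \<in> rank_one_elements (transpose ` W)"
    unfolding rank_one_elements_def by blast
qed

lemma rank_one_elements_transpose: "rank_one_elements (transpose ` W) = transpose ` rank_one_elements W"
  using image_mono[OF transpose_rank_one_elements_subset[of "transpose ` W"], of transpose]
  by (intro subset_antisym transpose_rank_one_elements_subset) (simp add: transpose_transpose_image)

lemma card_transpose_image: "card (transpose ` W) = card W"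
  by (rule card_image) (metis inj_onI transpose_transpose)

text \<open>The inequality holds for every rank one member \<open>outer x y\<close> of
  \<open>W\<close>; it becomes useful when the sizes \<alpha> and \<beta> of the two factor spaces
  lie on the same side of q^2. It is multiplied by q^2 to clear the quotient of
  \<alpha>\<beta>.\<close>

lemma card_rank_one_elements_of_good_pair:
  fixes W :: "('a::{field,finite} ^ 'm::finite ^ 'l::finite) set"
  assumes W: "mat_subspace W" and xy: "x \<noteq> 0" "y \<noteq> 0" "outer x y \<in> W"
  shows "CARD('a)\<^sup>2 * card (rank_one_elements W) + card (right_factors W x) * card (left_factors W y)
      + CARD('a)\<^sup>2 * (CARD('a) + 1)
    \<le> CARD('a) * card W + CARD('a)\<^sup>2 * (card (right_factors W x) + card (left_factors W y))"
proof -
  define q where "q = CARD('a)"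
  define X where "X = right_factors W x"
  define Y where "Y = left_factors W y"
  define g where "g = (\<lambda>(v, u). outer x v + outer u y)"
  define T where "T = g ` (X \<times> Y)"
  define OX where "OX = outer x ` (X - {0})"
  define OY where "OY = (\<lambda>u. outer u y) ` (Y - {0})"
  define S where "S = rank_one_elements W - (OX \<union> OY)"
  have q2: "2 \<le> q" unfolding q_def by (rule card_field_ge_2)
  note sub = subspace_right_factors[OF W, of x, folded X_def] subspace_left_factors[OF W, of y, folded Y_def]
  have mem: "v \<in> X \<longleftrightarrow> outer x v \<in> W" "u \<in> Y \<longleftrightarrow> outer u y \<in> W" for u v
    by (simp_all add: X_def Y_def right_factors_def left_factors_def)
  have TW: "T \<subseteq> W"
    using mat_subspace_add[OF W] by (auto simp: T_def g_def mem)
  have 0: "0 \<in> X" "0 \<in> Y" using sub vec.subspace_0 by auto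
  have cardT: "card X * card Y = q * card T"
  proof -
    \<comment> \<open>The two products cancel only as opposite multiples of
      \<open>outer x y\<close>, which gives a kernel of q pairs.\<close>
    have "{p\<in>X \<times> Y. g p = 0} = (\<lambda>c. (c *s y, (- c) *s x)) ` UNIV"
    proof
      show "{p\<in>X \<times> Y. g p = 0} \<subseteq> (\<lambda>c. (c *s y, (- c) *s x)) ` UNIV"
      proof
        fix p assume "p \<in> {p\<in>X \<times> Y. g p = 0}"
        then obtain v u where p: "p = (v, u)" "outer x v + outer u y = 0"
          by (auto simp: g_def)
        then have e: "outer (- u) y = outer x v"
          by (simp add: matrix_eq_iff add_eq_0_iff2)
        show "p \<in> (\<lambda>c. (c *s y, (- c) *s x)) ` UNIV"
        proof (cases "v = 0")
          case True
          then have "u = 0" using p xy by simp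
          then show ?thesis using True p by (intro image_eqI[of _ _ 0]) auto
        next
          case False
          then obtain c where c: "- u = c *s x" "v = c *s y" using e xy by (metis outer_eq_outerE)
          have "u = - (c *s x)" using c(1) by (metis minus_minus)
          then have "p = (c *s y, (- c) *s x)" using p c by simp
          then show ?thesis by blast
        qed
      qed
      show "(\<lambda>c. (c *s y, (- c) *s x)) ` UNIV \<subseteq> {p\<in>X \<times> Y. g p = 0}"
      proof clarify
        fix c
        have "c *s y \<in> X" "(- c) *s x \<in> Y"
          using mat_subspace_scale[OF W xy(3)] by (simp_all only: mem outer_scale_left outer_scale_right)
        moreover have "g (c *s y, (- c) *s x) = 0" by (simp add: g_def matrix_eq_iff)
        ultimately show "(c *s y, (- c) *s x) \<in> X \<times> Y \<and> g (c *s y, (- c) *s x) = 0" by blast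
      qed
    qed
    moreover have "inj (\<lambda>c. (c *s y, (- c) *s x))" using xy by (auto intro!: injI)
    ultimately have "card {p\<in>X \<times> Y. g p = 0} = q" by (simp add: card_image q_def)
    moreover have "card (X \<times> Y) = card {p\<in>X \<times> Y. g p = 0} * card (g ` (X \<times> Y))"
    proof (rule card_eq_card_kernel_times_card_image)
      show "p - p' \<in> X \<times> Y" if "p \<in> X \<times> Y" "p' \<in> X \<times> Y" for p p'
        using that sub by (cases p; cases p') (simp add: vec.subspace_diff)
      show "g (p - p') = g p - g p'" for p p'
        by (cases p; cases p') (simp add: g_def outer_diff_left outer_diff_right)
    qed simp
    ultimately show ?thesis by (simp add: T_def card_cartesian_product)
  qed
  have S: "\<exists>a b. s = outer a b" "s \<in> W" "s \<notin> OX" "s \<notin> OY" "s \<noteq> 0" if "s \<in> S" for s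
    using that by (auto simp: S_def rank_one_elements_def)
  have notX: "s \<noteq> outer x v" if s: "s \<in> S" for s v
    using S(2,3,5)[OF s] by (auto simp: OX_def mem)
  have notY: "s \<noteq> outer u y" if s: "s \<in> S" for s u
    using S(2,4,5)[OF s] by (auto simp: OY_def mem)
  \<comment> \<open>By the minors, \<open>outer u y + outer x v\<close> is an outer product only if
    \<open>u\<close> is a multiple of \<open>x\<close> or \<open>v\<close> of \<open>y\<close>. It
    then collapses to one product with factor \<open>x\<close> or \<open>y\<close>, and the nonzero
    ones of these were removed from \<open>S\<close>.\<close>
  have notT: "s \<notin> T" if s: "s \<in> S" for s
  proof
    assume "s \<in> T"
    then obtain v u where vu: "s = outer x v + outer u y" by (auto simp: T_def g_def)
    obtain a b where "s = outer a b" using S(1)[OF s] by blast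
    then have "outer u y + outer x v = outer a b" using vu by (simp add: add.commute)
    from outer_add_eq_outerD[OF this]
    have "(\<exists>c. u = c *s x) \<or> (\<exists>c. v = c *s y)"
      using proportionalI[of u x] proportionalI[of v y] xy by (metis mult.commute)
    then show False
    proof (elim disjE exE)
      fix c assume "u = c *s x"
      then have "s = outer x (v + c *s y)"
        by (simp add: vu outer_scale_left outer_scale_right outer_add_right)
      then show False using notX[OF s] by blast
    next
      fix c assume "v = c *s y"
      then have "s = outer (c *s x + u) y"
        by (simp add: vu outer_scale_left outer_scale_right outer_add_left)
      then show False using notY[OF s] by blast
    qed
  qed
  \<comment> \<open>\<open>S\<close> is translated along the line of \<open>outer x y\<close>. If
    two translates met, a member of \<open>S\<close> plus a nonzero multiple of
    \<open>outer x y\<close> would again be an outer product, so it would share a factor with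
    \<open>outer x y\<close>.\<close>
  define h where "h = (\<lambda>(s, c). s + mat_scale c (outer x y))"
  have inj: "inj_on h (S \<times> UNIV)"
  proof (rule inj_onI, clarsimp simp: h_def)
    fix s s' c c' assume s: "s \<in> S" "s' \<in> S"
      and eq: "s + mat_scale c (outer x y) = s' + mat_scale c' (outer x y)"
    have "s + outer ((c - c') *s x) y = s'"
      using eq by (simp add: matrix_eq_iff algebra_simps)
    moreover obtain a b where ab: "s = outer a b" using S(1)[OF s(1)] by blast
    moreover obtain a' b' where "s' = outer a' b'" using S(1)[OF s(2)] by blast
    ultimately have eq': "outer a b + outer ((c - c') *s x) y = outer a' b'" by simp
    have "c = c'"
    proof (rule ccontr)
      assume "c \<noteq> c'"
      then have "(c - c') *s x \<noteq> 0" using xy by simp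
      with outer_add_eq_outerD[OF eq'] have "(\<exists>d. a = d *s ((c - c') *s x)) \<or> (\<exists>d. b = d *s y)"
        using proportionalI[of a "(c - c') *s x"] proportionalI[of b y] xy by blast
      then show False
      proof (elim disjE exE)
        fix d assume "a = d *s ((c - c') *s x)"
        then have "s = outer x ((d * (c - c')) *s b)"
          by (simp only: ab outer_scale_left outer_scale_right mat_scale_mat_scale)
        then show False using notX[OF s(1)] by blast
      next
        fix d assume "b = d *s y"
        then have "s = outer (d *s a) y" by (simp add: ab outer_scale_left outer_scale_right)
        then show False using notY[OF s(1)] by blast
      qed
    qed
    then show "s = s' \<and> c = c'" using eq by simp
  qed
  \<comment> \<open>\<open>T\<close> contains the line of \<open>outer x y\<close>, so a translation
    along it cannot enter \<open>T\<close> from outside.\<close>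
  have "h ` (S \<times> UNIV) \<subseteq> W - T"
  proof clarsimp
    fix s c assume s: "s \<in> S"
    have "s \<in> T" if "h (s, c) \<in> T"
    proof -
      obtain v u where vu: "v \<in> X" "u \<in> Y" "h (s, c) = outer x v + outer u y"
        using \<open>h (s, c) \<in> T\<close> by (auto simp: T_def g_def)
      then have "s = outer x (v - c *s y) + outer u y"
        by (simp add: h_def outer_diff_right outer_scale_right algebra_simps eq_diff_eq)
      moreover have "c *s y \<in> X" using xy(3) mat_subspace_scale[OF W] by (simp add: mem outer_scale_right)
      then have "v - c *s y \<in> X" using vu sub by (simp add: vec.subspace_diff)
      ultimately show ?thesis using vu(2) by (auto simp: T_def g_def)
    qed
    then show "h (s, c) \<in> W \<and> h (s, c) \<notin> T"
      using notT[OF s] S(2)[OF s] xy(3) by (auto simp: h_def mat_subspace_add mat_subspace_scale W)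
  qed
  then have "card (h ` (S \<times> UNIV)) \<le> card (W - T)" by (intro card_mono) auto
  then have SW: "q * card S + card T \<le> card W"
    using card_mono[OF _ TW] TW
    by (simp add: card_image[OF inj] card_cartesian_product card_Diff_subset q_def mult.commute)
  \<comment> \<open>Both sets contain the q - 1 nonzero multiples of \<open>outer x y\<close>, so
    the union has at most (\<alpha> - 1) + (\<beta> - 1) - (q - 1) elements.\<close>
  have OXY: "card (OX \<union> OY) + q + 1 \<le> card X + card Y"
  proof -
    have "card X = card (X - {0}) + 1" "card Y = card (Y - {0}) + 1"
      using 0 card_Suc_Diff1[of X 0] card_Suc_Diff1[of Y 0] by simp_all
    moreover have "card OX \<le> card (X - {0})" "card OY \<le> card (Y - {0})"
      unfolding OX_def OY_def by (simp_all add: card_image_le)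
    moreover have "q - 1 \<le> card (OX \<inter> OY)"
    proof -
      have "inj_on (\<lambda>c. mat_scale c (outer x y)) (UNIV - {0})"
      proof (rule inj_onI)
        fix c c' assume "mat_scale c (outer x y) = mat_scale c' (outer x y)"
        then have "outer ((c - c') *s x) y = 0"
          by (simp add: matrix_eq_iff algebra_simps)
        then show "c = c'" using xy by simp
      qed
      then have "card ((\<lambda>c. mat_scale c (outer x y)) ` (UNIV - {0})) = q - 1"
        by (simp add: card_image q_def card_Diff_subset)
      moreover have "(\<lambda>c. mat_scale c (outer x y)) ` (UNIV - {0}) \<subseteq> OX \<inter> OY"
      proof (rule image_subsetI)
        fix c :: 'a assume "c \<in> UNIV - {0}"
        then have c: "c \<noteq> 0" by simp
        have "c *s y \<in> X - {0}" "c *s x \<in> Y - {0}"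
          using c xy mat_subspace_scale[OF W] by (simp_all add: mem outer_scale_left outer_scale_right)
        then show "mat_scale c (outer x y) \<in> OX \<inter> OY"
          unfolding OX_def OY_def Int_iff by (metis image_eqI outer_scale_left outer_scale_right)
      qed
      ultimately show ?thesis by (metis card_mono finite)
    qed
    moreover have "card (OX \<union> OY) + card (OX \<inter> OY) = card OX + card OY"
      using card_Un_Int[of OX OY] by simp
    ultimately show ?thesis using q2 by linarith
  qed
  have "card (rank_one_elements W) \<le> card S + card (OX \<union> OY)"
  proof -
    have "rank_one_elements W \<subseteq> S \<union> (OX \<union> OY)" by (auto simp: S_def)
    then have "card (rank_one_elements W) \<le> card (S \<union> (OX \<union> OY))" by (intro card_mono) auto
    also have "\<dots> \<le> card S + card (OX \<union> OY)" by (rule card_Un_le)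
    finally show ?thesis .
  qed
  with OXY have "card (rank_one_elements W) + q + 1 \<le> card S + (card X + card Y)" by linarith
  then have "q\<^sup>2 * (card (rank_one_elements W) + q + 1) \<le> q\<^sup>2 * (card S + (card X + card Y))"
    by (rule mult_le_mono2)
  moreover have "q * (q * card S + card T) \<le> q * card W" using SW by simp
  ultimately have "q\<^sup>2 * card (rank_one_elements W) + card X * card Y + q\<^sup>2 * (q + 1)
      \<le> q * card W + q\<^sup>2 * (card X + card Y)"
    unfolding cardT by (simp add: algebra_simps power2_eq_square)
  then show ?thesis by (simp only: q_def X_def Y_def)
qed

text \<open>The left factors that occur with a given \<open>v\<close> form a single line, so the
  right factor determines an element up to a scalar. Once this scalar is moved into
  \<open>v\<close>, the nonzero vectors \<open>v\<close> index all rank one elements.\<close>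

lemma card_rank_one_elements_of_small_left_factors:
  fixes W :: "('a::{field,finite} ^ 'm::finite ^ 'l::finite) set"
  assumes W: "mat_subspace W"
    and small: "\<And>u v. u \<noteq> 0 \<Longrightarrow> v \<noteq> 0 \<Longrightarrow> outer u v \<in> W \<Longrightarrow> card (left_factors W v) = CARD('a)"
  shows "card (rank_one_elements W) < CARD('a) ^ CARD('m)"
proof -
  \<comment> \<open>The choice depends on \<open>v\<close> only through
    \<open>left_factors W v\<close>, hence not on the scaling of \<open>v\<close>. Where no nonzero
    left factor exists the value is arbitrary and can only enlarge the covering set.\<close>
  define s where "s v = (SOME u. u \<in> left_factors W v \<and> u \<noteq> 0)" for v
  have "rank_one_elements W \<subseteq> (\<lambda>v. outer (s v) v) ` (UNIV - {0})"
  proof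
    fix A assume "A \<in> rank_one_elements W"
    then obtain u w where A: "A = outer u w" "u \<noteq> 0" "w \<noteq> 0" "A \<in> W"
      by (auto simp: rank_one_elements_def)
    have "\<exists>u. u \<in> left_factors W w \<and> u \<noteq> 0" using A by (auto simp: left_factors_def)
    then have s: "s w \<in> left_factors W w" "s w \<noteq> 0" unfolding s_def by (metis (mono_tags, lifting) someI_ex)+
    have "range (\<lambda>c. c *s s w) \<subseteq> left_factors W w"
      using s subspace_left_factors[OF W] by (auto intro: vec.subspace_scale)
    moreover have "card (range (\<lambda>c. c *s s w)) = CARD('a)"
      using s by (intro card_image injI) auto
    ultimately have "range (\<lambda>c. c *s s w) = left_factors W w"
      using small[of u w] A by (intro card_subset_eq) auto
    moreover have "u \<in> left_factors W w" using A by (simp add: left_factors_def)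
    ultimately obtain c where c: "u = c *s s w" by blast
    then have "c \<noteq> 0" using A by auto
    then have "s (c *s w) = s w" by (simp add: s_def left_factors_scale[OF W])
    then have "A = outer (s (c *s w)) (c *s w)"
      by (simp add: A c outer_scale_left outer_scale_right)
    moreover have "c *s w \<in> UNIV - {0}" using \<open>c \<noteq> 0\<close> A by simp
    ultimately show "A \<in> (\<lambda>v. outer (s v) v) ` (UNIV - {0})" by blast
  qed
  then have "card (rank_one_elements W) \<le> card (UNIV - {0 :: 'a ^ 'm})"
    by (meson card_image_le card_mono finite order_trans)
  also have "\<dots> < card (UNIV :: ('a ^ 'm) set)" by (intro psubset_card_mono) auto
  finally show ?thesis by simp
qed

text \<open>Members of the counted set are translated by all \<open>outer u y0\<close> in
  \<open>W\<close> without collisions. If two translates coincide with \<open>u \<noteq> u'\<close>,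
  the minors make \<open>a\<close> proportional to \<open>u - u'\<close> or \<open>b\<close> to
  \<open>y0\<close>. Then \<open>outer (u - u') y0\<close> or \<open>outer a b\<close> has large
  factor spaces on both sides, which \<open>not_both\<close> forbids.\<close>

lemma card_large_right_factors_le:
  fixes W :: "('a::{field,finite} ^ 'm::finite ^ 'l::finite) set"
  assumes W: "mat_subspace W"
    and large: "y0 \<noteq> 0" "n < card (left_factors W y0)"
    and not_both: "\<And>u v. u \<noteq> 0 \<Longrightarrow> v \<noteq> 0 \<Longrightarrow> outer u v \<in> W \<Longrightarrow>
      n < card (right_factors W u) \<Longrightarrow> \<not> n < card (left_factors W v)"
  shows "n * card {A\<in>W. \<exists>u v. u \<noteq> 0 \<and> v \<noteq> 0 \<and> A = outer u v \<and> n < card (right_factors W u)} \<le> card W"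
    (is "n * card ?T \<le> _")
proof -
  let ?h = "\<lambda>(s, u). s + outer u y0"
  let ?Y = "left_factors W y0"
  have inj: "inj_on ?h (?T \<times> ?Y)"
  proof (rule inj_onI, clarsimp)
    fix a a' :: "'a ^ 'l" and b b' :: "'a ^ 'm" and u u'
    assume ab: "outer a b \<in> W" "a \<noteq> 0" "b \<noteq> 0" "n < card (right_factors W a)"
      and ab': "outer a' b' \<in> W" "a' \<noteq> 0" "b' \<noteq> 0" "n < card (right_factors W a')"
      and u: "u \<in> ?Y" "u' \<in> ?Y"
      and eq: "outer a b + outer u y0 = outer a' b' + outer u' y0"
    have eq': "outer a b + outer (u - u') y0 = outer a' b'"
      using eq by (simp add: outer_diff_left algebra_simps)
    have "u = u'"
    proof (rule ccontr)
      assume "u \<noteq> u'"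
      then have w: "u - u' \<noteq> 0" by simp
      with outer_add_eq_outerD[OF eq'] have "(\<exists>d. a = d *s (u - u')) \<or> (\<exists>d. b = d *s y0)"
        using proportionalI[of a "u - u'"] proportionalI[of b y0] large(1) by blast
      then show False
      proof (elim disjE exE)
        fix d assume "a = d *s (u - u')"
        moreover from this have "d \<noteq> 0" using ab(2) by auto
        ultimately have "right_factors W a = right_factors W (u - u')"
          by (metis right_factors_scale[OF W])
        moreover have "outer (u - u') y0 \<in> W"
          using vec.subspace_diff[OF subspace_left_factors[OF W] u] by (simp add: left_factors_def)
        ultimately show False using not_both[OF w large(1)] ab(4) large(2) by simp
      next
        fix d assume "b = d *s y0"
        moreover from this have "d \<noteq> 0" using ab(3) by auto
        ultimately have "left_factors W b = left_factors W y0"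
          by (metis left_factors_scale[OF W])
        then show False using not_both[OF ab(2,3,1,4)] large(2) by simp
      qed
    qed
    then show "outer a b = outer a' b' \<and> u = u'" using eq by simp
  qed
  have "?h ` (?T \<times> ?Y) \<subseteq> W"
    using mat_subspace_add[OF W] by (auto simp: left_factors_def)
  then have "card (?h ` (?T \<times> ?Y)) \<le> card W" by (rule card_mono[OF finite])
  then have "card (?T \<times> ?Y) \<le> card W" by (simp only: card_image[OF inj])
  then have "card ?T * card ?Y \<le> card W" by (simp only: card_cartesian_product)
  moreover have "n * card ?T \<le> card ?T * card ?Y"
    unfolding mult.commute[of n] by (rule mult_le_mono2) (use large(2) in simp)
  ultimately show ?thesis by (rule order_trans[rotated])
qed

lemma card_large_left_factors_le:
  fixes W :: "('a::{field,finite} ^ 'm::finite ^ 'l::finite) set"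
  assumes W: "mat_subspace W"
    and large: "x0 \<noteq> 0" "n < card (right_factors W x0)"
    and not_both: "\<And>u v. u \<noteq> 0 \<Longrightarrow> v \<noteq> 0 \<Longrightarrow> outer u v \<in> W \<Longrightarrow>
      n < card (right_factors W u) \<Longrightarrow> \<not> n < card (left_factors W v)"
  shows "n * card {A\<in>W. \<exists>u v. u \<noteq> 0 \<and> v \<noteq> 0 \<and> A = outer u v \<and> n < card (left_factors W v)} \<le> card W"
    (is "n * card ?T \<le> _")
proof -
  let ?W = "transpose ` W"
  let ?T' = "{A\<in>?W. \<exists>u v. u \<noteq> 0 \<and> v \<noteq> 0 \<and> A = outer u v \<and> n < card (right_factors ?W u)}"
  have "n * card ?T' \<le> card ?W"
  proof (rule card_large_right_factors_le[OF mat_subspace_transpose[OF W]])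
    show "x0 \<noteq> 0" "n < card (left_factors ?W x0)" using large by (simp_all add: left_factors_transpose)
    fix u :: "'a ^ 'm" and v :: "'a ^ 'l"
    assume "u \<noteq> 0" "v \<noteq> 0" "outer u v \<in> ?W" "n < card (right_factors ?W u)"
    moreover from this have "outer v u \<in> W" by (simp add: outer_mem_transpose_image)
    ultimately show "\<not> n < card (left_factors ?W v)"
      using not_both[of v u] by (auto simp: left_factors_transpose right_factors_transpose)
  qed
  moreover have "transpose ` ?T \<subseteq> ?T'"
  proof
    fix A assume "A \<in> transpose ` ?T"
    then obtain u v where "u \<noteq> 0" "v \<noteq> 0" "outer u v \<in> W" "A = outer v u" "n < card (left_factors W v)"
      by (auto simp: transpose_outer)
    moreover from this have "A \<in> ?W" by (simp add: outer_mem_transpose_image)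
    ultimately show "A \<in> ?T'" unfolding right_factors_transpose by blast
  qed
  then have "card ?T \<le> card ?T'"
    using card_mono[OF finite, of "transpose ` ?T" ?T'] by (simp only: card_transpose_image)
  then have "n * card ?T \<le> n * card ?T'" by (rule mult_le_mono2)
  ultimately show ?thesis by (simp only: card_transpose_image)
qed

lemma card_subspace_cases:
  fixes S :: "('a::{field,finite} ^ 'n::finite) set"
  assumes "vec.subspace S" "v \<in> S" "v \<noteq> 0"
  shows "card S = CARD('a) \<or> CARD('a)\<^sup>2 \<le> card S"
proof -
  have "vec.dim S \<noteq> 0" using assms by auto
  then consider "vec.dim S = 1" | "2 \<le> vec.dim S" by linarith
  then show ?thesis
    using card_subspace[OF assms(1)] power_increasing[of 2 "vec.dim S" "CARD('a)"]
      card_field_ge_2[where 'a = 'a] by cases auto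
qed

text \<open>The combination on the left is q times the total deficit of the rank one elements and of
  zero in \<open>support_weight_ge_large_dim\<close>: 1 for each of the former and q + 1 for the
  latter.\<close>

lemma card_rank_one_elements_le:
  fixes W :: "('a::{field,finite} ^ 'm::finite ^ 'l::finite) set"
  assumes W: "mat_subspace W" and card: "card W = CARD('a) ^ r"
    and r: "CARD('l) < r" "CARD('m) < r"
  shows "CARD('a) * (card (rank_one_elements W) + CARD('a) + 1) \<le> CARD('a) ^ r + CARD('a) ^ 3"
proof -
  define q where "q = CARD('a)"
  define N where "N = card (rank_one_elements W)"
  define R where "R u = card (right_factors W u)" for u
  define L where "L v = card (left_factors W v)" for v
  have q2: "2 \<le> q" unfolding q_def by (rule card_field_ge_2)
  have R: "R u = q \<or> q\<^sup>2 \<le> R u" and L: "L v = q \<or> q\<^sup>2 \<le> L v"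
    if "u \<noteq> 0" "v \<noteq> 0" "outer u v \<in> W" for u v
    using card_subspace_cases[OF subspace_right_factors[OF W], of v u]
      card_subspace_cases[OF subspace_left_factors[OF W], of u v] that
    by (auto simp: R_def L_def q_def right_factors_def left_factors_def)
  have qq: "q * 2 \<le> q * q" "q * (q * 2) \<le> q * (q * q)" using q2 by simp_all
  \<comment> \<open>This serves the cases where one factor determines the element up to a scalar:
    there \<open>N\<close> is below q^m or q^l, and \<open>r\<close> exceeds both exponents.\<close>
  have small: ?thesis if "N < q ^ k" "k < r" for k
  proof -
    have "q * (N + 1) \<le> q * q ^ k" using that(1) by (intro mult_left_mono) auto
    also have "\<dots> \<le> q ^ r" using that(2) q2 power_increasing[of "Suc k" r q] by simp
    finally have "q * (N + 1) \<le> q ^ r" .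
    moreover have "q * q \<le> q ^ 3" using qq(2) by (simp add: power3_eq_cube)
    ultimately show ?thesis
      by (simp add: algebra_simps flip: q_def N_def)
  qed
  show ?thesis
  proof (cases "\<exists>x y. x \<noteq> 0 \<and> y \<noteq> 0 \<and> outer x y \<in> W \<and>
      (R x \<le> q\<^sup>2 \<and> L y \<le> q\<^sup>2 \<or> q\<^sup>2 \<le> R x \<and> q\<^sup>2 \<le> L y)")
    case True
    then obtain x y where xy: "x \<noteq> 0" "y \<noteq> 0" "outer x y \<in> W"
      and good: "R x \<le> q\<^sup>2 \<and> L y \<le> q\<^sup>2 \<or> q\<^sup>2 \<le> R x \<and> q\<^sup>2 \<le> L y" by blast
    have main: "q\<^sup>2 * N + R x * L y + q\<^sup>2 * (q + 1) \<le> q * q ^ r + q\<^sup>2 * (R x + L y)"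
      using card_rank_one_elements_of_good_pair[OF W xy]
      by (simp only: card q_def N_def R_def L_def)
    \<comment> \<open>Integers are needed as both differences may be negative. Expanded, the product
      bounds q^2 (\<alpha> + \<beta>) by \<alpha>\<beta> + q^4.\<close>
    have "0 \<le> (int (q\<^sup>2) - int (R x)) * (int (q\<^sup>2) - int (L y))"
      using good by (auto simp only: zero_le_mult_iff of_nat_le_iff le_diff_eq diff_le_eq add_0)
    then have "int (q\<^sup>2 * (R x + L y)) \<le> int (R x * L y + q\<^sup>2 * q\<^sup>2)"
      by (simp add: algebra_simps)
    then have "q\<^sup>2 * (R x + L y) \<le> R x * L y + q\<^sup>2 * q\<^sup>2" by (simp only: of_nat_le_iff)
    with main have "q\<^sup>2 * N + q\<^sup>2 * (q + 1) \<le> q * q ^ r + q\<^sup>2 * q\<^sup>2" by linarith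
    moreover have "q\<^sup>2 * N + q\<^sup>2 * (q + 1) = q * (q * (N + q + 1))"
      "q * q ^ r + q\<^sup>2 * q\<^sup>2 = q * (q ^ r + q ^ 3)"
      by (simp_all add: algebra_simps power2_eq_square power3_eq_cube)
    ultimately have "q * (q * (N + q + 1)) \<le> q * (q ^ r + q ^ 3)" by argo
    then show ?thesis using q2 by (simp flip: q_def N_def)
  next
    case False
    then have bad: "R u < q\<^sup>2 \<and> q\<^sup>2 < L v \<or> q\<^sup>2 < R u \<and> L v < q\<^sup>2"
      if "u \<noteq> 0" "v \<noteq> 0" "outer u v \<in> W" for u v
      using that by (meson linorder_not_le order_less_imp_le)
    \<comment> \<open>Now every rank one element has one factor space smaller than q^2, hence of
      size q, and the other larger than q^2. Either the left spaces are always lines, or the right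
      ones are, or exceptions to both occur.\<close>
    consider "\<And>u v. u \<noteq> 0 \<Longrightarrow> v \<noteq> 0 \<Longrightarrow> outer u v \<in> W \<Longrightarrow> L v = q"
      | "\<And>u v. u \<noteq> 0 \<Longrightarrow> v \<noteq> 0 \<Longrightarrow> outer u v \<in> W \<Longrightarrow> R u = q"
      | x y x' y' where "x \<noteq> 0" "y \<noteq> 0" "outer x y \<in> W" "L y \<noteq> q"
          "x' \<noteq> 0" "y' \<noteq> 0" "outer x' y' \<in> W" "R x' \<noteq> q"
      by blast
    then show ?thesis
    proof cases
      case 1
      then have "N < q ^ CARD('m)"
        using card_rank_one_elements_of_small_left_factors[OF W] unfolding L_def q_def N_def by blast
      then show ?thesis using small r by blast
    next
      case 2
      have "card (rank_one_elements (transpose ` W)) < q ^ CARD('l)"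
        unfolding q_def
      proof (rule card_rank_one_elements_of_small_left_factors[OF mat_subspace_transpose[OF W]])
        fix u :: "'a ^ 'm" and v :: "'a ^ 'l"
        assume uv: "u \<noteq> 0" "v \<noteq> 0" "outer u v \<in> transpose ` W"
        then have "outer v u \<in> W" by (simp add: outer_mem_transpose_image)
        then show "card (left_factors (transpose ` W) v) = CARD('a)"
          using 2[of v u] uv by (simp add: left_factors_transpose R_def q_def)
      qed
      then have "N < q ^ CARD('l)"
        by (simp add: N_def rank_one_elements_transpose card_transpose_image)
      then show ?thesis using small r by blast
    next
      case (3 x y x' y')
      define TR where "TR = {A\<in>W. \<exists>u v. u \<noteq> 0 \<and> v \<noteq> 0 \<and> A = outer u v \<and> q\<^sup>2 < card (right_factors W u)}"
      define TL where "TL = {A\<in>W. \<exists>u v. u \<noteq> 0 \<and> v \<noteq> 0 \<and> A = outer u v \<and> q\<^sup>2 < card (left_factors W v)}"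
      have large: "q\<^sup>2 < L y" "q\<^sup>2 < R x'"
        using bad[OF 3(1-3)] bad[OF 3(5-7)] L[OF 3(1-3)] R[OF 3(5-7)] 3(4,8) by auto
      have not_both: "\<not> q\<^sup>2 < card (left_factors W v)"
        if "u \<noteq> 0" "v \<noteq> 0" "outer u v \<in> W" "q\<^sup>2 < card (right_factors W u)" for u v
        using bad[OF that(1-3)] that(4) unfolding R_def L_def by linarith
      \<comment> \<open>Each kind has at most q^(r-2) members, and 2 \<le> q bounds their total by
        q^(r-1).\<close>
      have "q\<^sup>2 * card TR \<le> q ^ r" "q\<^sup>2 * card TL \<le> q ^ r"
        using card_large_right_factors_le[OF W 3(2) large(1)[unfolded L_def] not_both]
          card_large_left_factors_le[OF W 3(5) large(2)[unfolded R_def] not_both] card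
        by (simp_all add: TR_def TL_def q_def)
      moreover have "rank_one_elements W \<subseteq> TR \<union> TL"
        using bad unfolding rank_one_elements_def TR_def TL_def R_def L_def by blast
      then have "N \<le> card TR + card TL"
        unfolding N_def by (meson card_Un_le card_mono finite order_trans)
      then have "q\<^sup>2 * N \<le> q\<^sup>2 * (card TR + card TL)" by (rule mult_left_mono) simp
      ultimately have "q\<^sup>2 * N \<le> 2 * q ^ r" by (simp add: distrib_left)
      also have "\<dots> \<le> q * q ^ r" using q2 by simp
      finally have "q * N \<le> q ^ r" using q2 by (simp add: power2_eq_square)
      moreover have "q * q + q \<le> q ^ 3"
      proof -
        have "q * q + q \<le> q * (q * 2)" using qq(1) by simp
        also have "\<dots> \<le> q ^ 3" using qq(2) by (simp only: power3_eq_cube mult.assoc)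
        finally show ?thesis .
      qed
      ultimately show ?thesis by (simp add: algebra_simps flip: q_def N_def)
    qed
  qed
qed

section \<open>The encoding map and lower bounds for support weights\<close>

definition encode :: "('n \<Rightarrow> 'a::field ^ 'm ^ 'l) \<Rightarrow> 'a ^ 'm ^ 'l \<Rightarrow> 'a ^ 'n" where
  "encode M f = (\<chi> k. lin_eval f (M k))"

lemma encode_nth [simp]: "encode M f $ k = lin_eval f (M k)"
  by (simp add: encode_def)

lemma det_code_hat_eq_range: "det_code_hat M = range (encode M)"
  by (auto simp: det_code_hat_def encode_def)

lemma encode_add: "encode M (f + g) = encode M f + encode M g"
  and encode_diff: "encode M (f - g) = encode M f - encode M g"
  and encode_scale: "encode M (mat_scale c f) = c *s encode M f"
  by (simp_all add: vec_eq_iff lin_eval_add lin_eval_diff lin_eval_scale_left)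

lemma encode_0: "encode M 0 = 0"
  using encode_diff[of M 0 0] by simp

text \<open>A nonzero coefficient matrix has positive weight by \<open>weight_ge\<close>. Hence a
  subcode and its space of coefficient matrices have the same size.\<close>

lemma inj_encode:
  fixes M :: "'n::finite \<Rightarrow> 'a::{field,finite} ^ 'm::finite ^ 'l::finite"
  assumes M: "rank_one_representatives M"
  shows "inj (encode M)"
proof (rule injI)
  fix f g assume "encode M f = encode M g"
  then have "encode M (f - g) = 0" by (simp add: encode_diff)
  then have "{k. lin_eval (f - g) (M k) \<noteq> 0} = {}" by (simp add: vec_eq_iff)
  then have "card {k. lin_eval (f - g) (M k) \<noteq> 0} = 0" by (simp only: card.empty)
  moreover have "0 < CARD('a) ^ (CARD('l) + CARD('m))" by simp
  ultimately have "f - g = 0" using weight_ge[OF M, of "f - g"] by (metis mult_0_right not_le)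
  then show "f = g" by simp
qed

lemma subspace_encode_image:
  assumes "mat_subspace W"
  shows "vec.subspace (encode M ` W)"
proof (rule vec.subspaceI)
  show "0 \<in> encode M ` W" using mat_subspace_0[OF assms] encode_0 by (metis image_eqI)
  fix x y c assume "x \<in> encode M ` W" "y \<in> encode M ` W"
  then obtain f g where "x = encode M f" "y = encode M g" "f \<in> W" "g \<in> W" by blast
  then show "x + y \<in> encode M ` W" "c *s x \<in> encode M ` W"
    using mat_subspace_add[OF assms, of f g] mat_subspace_scale[OF assms, of f c]
    by (metis encode_add imageI, metis encode_scale imageI)
qed

lemma mat_subspace_encode_vimage:
  assumes "vec.subspace D"
  shows "mat_subspace (encode M -` D)"
  using assms unfolding mat_subspace_def
  by (simp add: encode_add encode_0 encode_scale vec.subspace_0 vec.subspace_add vec.subspace_scale)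

lemma support_weight_eq_sum:
  fixes M :: "'n::finite \<Rightarrow> 'a::{field,finite} ^ 'm::finite ^ 'l::finite"
  assumes M: "rank_one_representatives M" and D: "vec.subspace D" "D \<subseteq> det_code_hat M"
  shows "card (encode M -` D) = card D"
    and "CARD('a) * (\<Sum>f\<in>encode M -` D. card {k. lin_eval f (M k) \<noteq> 0}) = (CARD('a) - 1) * card D * support_weight D"
proof -
  have im: "encode M ` (encode M -` D) = D" using D(2) by (auto simp: det_code_hat_eq_range)
  have inj: "inj_on (encode M) (encode M -` D)" using inj_encode[OF M] by (rule inj_on_subset) simp
  show "card (encode M -` D) = card D" using card_image[OF inj] im by simp
  have "(\<Sum>c\<in>D. card {k. c $ k \<noteq> 0}) = (\<Sum>f\<in>encode M -` D. card {k. lin_eval f (M k) \<noteq> 0})"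
    using sum.reindex[OF inj, of "\<lambda>c. card {k. c $ k \<noteq> 0}"] im by simp
  then show "CARD('a) * (\<Sum>f\<in>encode M -` D. card {k. lin_eval f (M k) \<noteq> 0}) = (CARD('a) - 1) * card D * support_weight D"
    using sum_weight_eq[OF D(1)] by simp
qed

text \<open>Only the minimum weight is used: each of the q^r - 1 nonzero members of \<open>W\<close>
  weighs at least q^(l+m-2). The bound is sharp for r = m, where all nonzero members can have rank
  one.\<close>

lemma support_weight_ge:
  fixes M :: "'n::finite \<Rightarrow> 'a::{field,finite} ^ 'm::finite ^ 'l::finite"
  assumes M: "rank_one_representatives M"
    and D: "vec.subspace D" "D \<subseteq> det_code_hat M" "card D = CARD('a) ^ r"
  shows "(CARD('a) ^ r - 1) * CARD('a) ^ (CARD('l) + CARD('m))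
    \<le> CARD('a) * (CARD('a) - 1) * CARD('a) ^ r * support_weight D"
proof -
  define q where "q = CARD('a)"
  define W where "W = encode M -` D"
  define w where "w f = card {k. lin_eval f (M k) \<noteq> 0}" for f
  note W = support_weight_eq_sum[OF M D(1,2), folded W_def, unfolded D(3), folded q_def w_def]
  have "0 \<in> W" using D(1) by (simp add: W_def encode_0 vec.subspace_0)
  then have "card (W - {0}) = q ^ r - 1" using W(1) by simp
  then have "(q ^ r - 1) * q ^ (CARD('l) + CARD('m)) = (\<Sum>f\<in>W - {0}. q ^ (CARD('l) + CARD('m)))" by simp
  also have "\<dots> \<le> (\<Sum>f\<in>W - {0}. q\<^sup>2 * w f)"
    using weight_ge[OF M] unfolding q_def w_def by (intro sum_mono) blast
  also have "\<dots> \<le> (\<Sum>f\<in>W. q\<^sup>2 * w f)" by (intro sum_mono2) auto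
  also have "\<dots> = q * (q * (\<Sum>f\<in>W. w f))" by (simp add: sum_distrib_left power2_eq_square mult.assoc)
  finally show ?thesis unfolding W(2) by (simp add: q_def mult.assoc)
qed

text \<open>With \<open>Q\<close> = q^(l+m), the value q^3 \<open>w f\<close> is compared with (q +
  1) \<open>Q\<close>. A rank one \<open>f\<close> falls short by at most \<open>Q\<close> and zero
  by (q + 1) \<open>Q\<close>, so the sum over \<open>W\<close> loses at most (N + q + 1)
  \<open>Q\<close>, where N is the number of rank one elements.\<close>

lemma support_weight_ge_large_dim:
  fixes M :: "'n::finite \<Rightarrow> 'a::{field,finite} ^ 'm::finite ^ 'l::finite"
  assumes M: "rank_one_representatives M"
    and D: "vec.subspace D" "D \<subseteq> det_code_hat M" "card D = CARD('a) ^ r"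
    and r: "CARD('l) < r" "CARD('m) < r"
  shows "CARD('a) ^ (r + 1) * (CARD('a) + 1) * CARD('a) ^ (CARD('l) + CARD('m))
    \<le> CARD('a) ^ 3 * (CARD('a) - 1) * CARD('a) ^ r * support_weight D
      + (CARD('a) ^ r + CARD('a) ^ 3) * CARD('a) ^ (CARD('l) + CARD('m))"
proof -
  define q where "q = CARD('a)"
  define Q where "Q = CARD('a) ^ (CARD('l) + CARD('m))"
  define W where "W = encode M -` D"
  define w where "w f = card {k. lin_eval f (M k) \<noteq> 0}" for f
  define R where "R = rank_one_elements W"
  note W = support_weight_eq_sum[OF M D(1,2), folded W_def, unfolded D(3), folded q_def w_def]
  have mW: "mat_subspace W" unfolding W_def using D(1) by (rule mat_subspace_encode_vimage)
  have le: "(q + 1) * Q \<le> q ^ 3 * w f + (if f \<in> R then Q else 0) + (if f = 0 then (q + 1) * Q else 0)"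
    if f: "f \<in> W" for f
  proof (cases "f = 0")
    case False
    show ?thesis
    proof (cases "f \<in> R")
      case True
      have "q * Q \<le> q * (q\<^sup>2 * w f)"
        using weight_ge[OF M False] unfolding q_def w_def Q_def by (rule mult_le_mono2)
      then show ?thesis using True False by (simp add: power2_eq_square power3_eq_cube mult.assoc)
    next
      case False
      have "f \<noteq> outer u v" for u v
      proof
        assume uv: "f = outer u v"
        then have "u \<noteq> 0" "v \<noteq> 0" using \<open>f \<noteq> 0\<close> by auto
        then have "f \<in> R" using f uv unfolding R_def rank_one_elements_def by blast
        then show False using False by simp
      qed
      then show ?thesis using weight_ge_if_not_outer[OF M \<open>f \<noteq> 0\<close>] False \<open>f \<noteq> 0\<close>
        by (simp add: q_def w_def Q_def)
    qed
  qed simp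
  have RW: "R \<subseteq> W" by (auto simp: R_def rank_one_elements_def)
  have "q ^ r * ((q + 1) * Q) = (\<Sum>f\<in>W. (q + 1) * Q)" using W(1) by simp
  also have "\<dots> \<le> (\<Sum>f\<in>W. q ^ 3 * w f + (if f \<in> R then Q else 0) + (if f = 0 then (q + 1) * Q else 0))"
    by (rule sum_mono) (rule le)
  also have "\<dots> = q ^ 3 * (\<Sum>f\<in>W. w f) + card R * Q + (q + 1) * Q"
  proof -
    have "(\<Sum>f\<in>W. if f \<in> R then Q else 0) = card R * Q"
      using RW by (simp add: sum.If_cases Int_absorb1)
    moreover have "(\<Sum>f\<in>W. if f = 0 then (q + 1) * Q else 0) = (q + 1) * Q"
      using mat_subspace_0[OF mW] by simp
    ultimately show ?thesis by (simp only: sum.distrib sum_distrib_left)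
  qed
  finally have "q * (q ^ r * ((q + 1) * Q)) \<le> q * (q ^ 3 * (\<Sum>f\<in>W. w f) + card R * Q + (q + 1) * Q)"
    by (rule mult_le_mono2)
  also have "\<dots> = q ^ 3 * (q * (\<Sum>f\<in>W. w f)) + q * (card R + q + 1) * Q" by (simp add: algebra_simps)
  also have "\<dots> \<le> q ^ 3 * ((q - 1) * q ^ r * support_weight D) + (q ^ r + q ^ 3) * Q"
    unfolding W(2) using card_rank_one_elements_le[OF mW _ r] W(1)
    unfolding q_def R_def by (intro add_mono mult_le_mono1) auto
  finally show ?thesis by (simp only: q_def Q_def power_add power_one_right mult.assoc mult.left_commute)
qed

section \<open>Dimension of the code and existence of subcodes\<close>

lemma det_code_hat_subspace: "vec.subspace (det_code_hat M)"
  unfolding det_code_hat_eq_range by (rule subspace_encode_image) (simp add: mat_subspace_def)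

text \<open>Injectivity of \<open>encode\<close> gives q^(lm) codewords. Up to this dimension
  subcodes exist, so the minimum in \<open>gen_hamming_weight\<close> is over a nonempty
  set.\<close>

lemma dim_det_code_hat:
  fixes M :: "'n::finite \<Rightarrow> 'a::{field,finite} ^ 'm::finite ^ 'l::finite"
  assumes M: "rank_one_representatives M"
  shows "vec.dim (det_code_hat M) = CARD('l) * CARD('m)"
proof (rule dim_eq_if_card_eq[OF det_code_hat_subspace])
  show "card (det_code_hat M) = CARD('a) ^ (CARD('l) * CARD('m))"
    using card_image[OF inj_encode[OF M]]
    by (simp add: det_code_hat_eq_range mult.commute flip: power_mult)
qed

lemma subspace_of_smaller_dim:
  fixes C :: "('a::{field,finite} ^ 'n::finite) set"
  assumes C: "vec.subspace C" and r: "r \<le> vec.dim C"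
  shows "\<exists>D. vec.subspace D \<and> D \<subseteq> C \<and> vec.dim D = r"
proof -
  obtain B where B: "B \<subseteq> C" "vec.independent B" "card B = vec.dim C"
    using vec.basis_exists[of C] by metis
  obtain B' where B': "B' \<subseteq> B" "card B' = r"
    using obtain_subset_with_card_n[of r B] r B(3) by metis
  have "vec.span B' \<subseteq> C" using B B' C by (intro vec.span_minimal) auto
  moreover have "vec.dim (vec.span B') = r"
    using vec.dim_eq_card_independent[OF vec.independent_mono[OF B(2) B'(1)]] B' by (simp add: vec.dim_span)
  ultimately show ?thesis using vec.subspace_span by blast
qed

lemma gen_hamming_weight_attained:
  fixes C :: "('a::{field,finite} ^ 'n::finite) set"
  assumes C: "vec.subspace C" and r: "r \<le> vec.dim C"
  obtains D where "vec.subspace D" "D \<subseteq> C" "vec.dim D = r" "gen_hamming_weight C r = support_weight D"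
proof -
  let ?S = "{support_weight D | D. vec.subspace D \<and> D \<subseteq> C \<and> vec.dim D = r}"
  have "Min ?S \<in> ?S" using subspace_of_smaller_dim[OF C r] by (intro Min_in) auto
  then show ?thesis using that unfolding gen_hamming_weight_def by blast
qed

lemma gen_hamming_weight_le:
  fixes D :: "('a::{field,finite} ^ 'n::finite) set"
  assumes "vec.subspace D" "D \<subseteq> C" "vec.dim D = r"
  shows "gen_hamming_weight C r \<le> support_weight D"
  unfolding gen_hamming_weight_def using assms by (intro Min_le) auto

section \<open>Upper bounds from explicit matrix spaces\<close>

lemma gen_hamming_weight_le_support:
  fixes M :: "'n::finite \<Rightarrow> 'a::{field,finite} ^ 'm::finite ^ 'l::finite"
    and W :: "('a ^ 'm ^ 'l) set"
  assumes M: "rank_one_representatives M"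
    and W: "mat_subspace W" "card W = CARD('a) ^ r"
  shows "(CARD('a) - 1)\<^sup>2 * gen_hamming_weight (det_code_hat M) r
    \<le> card {(u, v). u \<noteq> 0 \<and> v \<noteq> 0 \<and> (\<exists>f\<in>W. lin_eval f (outer u v) \<noteq> 0)}"
proof -
  let ?D = "encode M ` W"
  have "card ?D = CARD('a) ^ r"
    using card_image[OF inj_on_subset[OF inj_encode[OF M]], of W] W(2) by simp
  then have "vec.dim ?D = r" by (rule dim_eq_if_card_eq[OF subspace_encode_image[OF W(1)]])
  then have "gen_hamming_weight (det_code_hat M) r \<le> support_weight ?D"
    by (intro gen_hamming_weight_le subspace_encode_image W(1)) (auto simp: det_code_hat_eq_range)
  also have "support_weight ?D = card {k. \<exists>f\<in>W. lin_eval f (M k) \<noteq> 0}"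
    by (simp add: support_weight_def)
  finally have "(CARD('a) - 1)\<^sup>2 * gen_hamming_weight (det_code_hat M) r
      \<le> (CARD('a) - 1)\<^sup>2 * card {k. \<exists>f\<in>W. lin_eval f (M k) \<noteq> 0}" by (rule mult_le_mono2)
  \<comment> \<open>Counting pairs of factors makes the bound independent of the choice of
    \<open>M\<close>; every coordinate accounts for (q - 1)^2 pairs.\<close>
  also have "\<dots> = card {(u, v). u \<noteq> 0 \<and> v \<noteq> 0 \<and> (\<exists>f\<in>W. lin_eval f (outer u v) \<noteq> 0)}"
    by (rule card_rank_one_pairs[OF M, symmetric]) (simp add: lin_eval_scale_right)
  finally show ?thesis .
qed

lemma lin_eval_outer_outer: "lin_eval (outer a b) (outer u v) = dot a u * dot b v"
  unfolding lin_eval_def dot_def outer_nth sum_product by (intro sum.cong refl) (simp only: mult_ac)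

lemma dot_axis: "dot (axis i 1) u = u $ i"
  by (simp add: dot_def axis_def if_distrib[where f = "\<lambda>x. x * y" for y] cong: if_cong)

lemma dot_axis_scale: "dot (c *s axis i 1) u = c * u $ i"
proof -
  have "dot (c *s axis i 1) u = c * dot (axis i 1) u" by (simp add: dot_def sum_distrib_left mult.assoc)
  then show ?thesis by (simp add: dot_axis)
qed

lemma ex_dot_neq_0:
  fixes w :: "'a::field ^ 'n::finite"
  assumes "w \<noteq> 0"
  shows "\<exists>v. dot v w \<noteq> 0"
proof -
  obtain i where "w $ i \<noteq> 0" using assms by (auto simp: vec_eq_iff)
  then have "dot (axis i 1) w \<noteq> 0" by (simp add: dot_axis)
  then show ?thesis by blast
qed

text \<open>The matrices supported on row \<open>i\<close> are used: one of them is nonzero at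
  \<open>outer u v\<close> exactly if \<open>u $ i \<noteq> 0\<close> and
  \<open>v \<noteq> 0\<close>, since some functional detects a nonzero \<open>v\<close>.\<close>

lemma gen_hamming_weight_row_le:
  fixes M :: "'n::finite \<Rightarrow> 'a::{field,finite} ^ 'm::finite ^ 'l::finite"
  assumes M: "rank_one_representatives M"
  shows "CARD('a) * (CARD('a) - 1) * gen_hamming_weight (det_code_hat M) CARD('m)
    \<le> CARD('a) ^ CARD('l) * (CARD('a) ^ CARD('m) - 1)"
proof -
  fix i :: 'l
  define q where "q = CARD('a)"
  define e :: "'a ^ 'l" where "e = axis i 1"
  have q2: "2 \<le> q" unfolding q_def by (rule card_field_ge_2)
  have e: "e \<noteq> 0" by (simp add: e_def axis_eq_0_iff)
  have sub: "mat_subspace (range (outer e :: 'a ^ 'm \<Rightarrow> _))"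
    unfolding mat_subspace_def
    by (auto simp flip: outer_add_right outer_scale_right intro: range_eqI[of _ _ 0])
  have "inj (outer e :: 'a ^ 'm \<Rightarrow> _)"
  proof (rule injI)
    fix v v' :: "'a ^ 'm" assume "outer e v = outer e v'"
    then have "outer e (v - v') = 0" by (simp add: outer_diff_right)
    then show "v = v'" using e by simp
  qed
  then have "card (range (outer e :: 'a ^ 'm \<Rightarrow> _)) = CARD('a) ^ CARD('m)" by (simp add: card_image)
  from gen_hamming_weight_le_support[OF M sub this, folded q_def]
  have "(q - 1)\<^sup>2 * gen_hamming_weight (det_code_hat M) CARD('m)
      \<le> card {(u, v). u \<noteq> 0 \<and> v \<noteq> 0 \<and> (\<exists>f\<in>range (outer e :: 'a ^ 'm \<Rightarrow> _). lin_eval f (outer u v) \<noteq> 0)}" .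
  also have "{(u, v). u \<noteq> 0 \<and> v \<noteq> 0 \<and> (\<exists>f\<in>range (outer e :: 'a ^ 'm \<Rightarrow> _). lin_eval f (outer u v) \<noteq> 0)} = {u. u $ i \<noteq> 0} \<times> (UNIV - {0 :: 'a ^ 'm})"
    using ex_dot_neq_0 by (auto simp: lin_eval_outer_outer e_def dot_axis)
  also have "card \<dots> = card {u::'a ^ 'l. u $ i \<noteq> 0} * (q ^ CARD('m) - 1)"
    by (simp add: card_cartesian_product card_Diff_subset q_def)
  finally have "q * ((q - 1)\<^sup>2 * gen_hamming_weight (det_code_hat M) CARD('m))
      \<le> q * (card {u::'a ^ 'l. u $ i \<noteq> 0} * (q ^ CARD('m) - 1))" by (rule mult_le_mono2)
  also have "\<dots> = (q - 1) * (q ^ CARD('l) * (q ^ CARD('m) - 1))"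
    using card_nonzero_coordinate[OF vec.subspace_UNIV, of e i]
    by (simp add: e_def q_def flip: mult.assoc)
  finally have "(q - 1) * (q * (q - 1) * gen_hamming_weight (det_code_hat M) CARD('m))
      \<le> (q - 1) * (q ^ CARD('l) * (q ^ CARD('m) - 1))"
    by (simp only: power2_eq_square mult.assoc mult.left_commute)
  then show ?thesis using q2 by (simp add: q_def)
qed

text \<open>Adding the entry in row \<open>i'\<close> and column \<open>j\<close> to the matrices
  supported on row \<open>i\<close> costs only the pairs with \<open>u $ i = 0\<close>,
  \<open>u $ i' \<noteq> 0\<close> and \<open>v $ j \<noteq> 0\<close>. There are (q - 1)^2
  q^(l+m-3) of them, whence the increment q^(l+m-3).\<close>

lemma gen_hamming_weight_row_plus_entry_le:
  fixes M :: "'n::finite \<Rightarrow> 'a::{field,finite} ^ 'm::finite ^ 'l::finite"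
  assumes M: "rank_one_representatives M" and l: "2 \<le> CARD('l)"
  shows "CARD('a) ^ 3 * (CARD('a) - 1) * gen_hamming_weight (det_code_hat M) (CARD('m) + 1)
    \<le> CARD('a)\<^sup>2 * (CARD('a) ^ CARD('l) * (CARD('a) ^ CARD('m) - 1))
      + (CARD('a) - 1) * (CARD('a) ^ CARD('l) * CARD('a) ^ CARD('m))"
proof -
  fix j :: 'm
  define q where "q = CARD('a)"
  define L where "L = q ^ CARD('l)"
  obtain i i' :: 'l where i: "i \<noteq> i'"
    using l by (metis (full_types) One_nat_def card_1_singleton_iff UNIV_eq_I insertI1 not_less_eq_eq numeral_2_eq_2 order_refl singleton_iff)
  define e :: "'a ^ 'l" where "e = axis i 1"
  define e' :: "'a ^ 'l" where "e' = axis i' 1"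
  define b :: "'a ^ 'm" where "b = axis j 1"
  define g where "g = (\<lambda>(v, c). outer e v + outer e' (c *s b))"
  have q2: "2 \<le> q" unfolding q_def by (rule card_field_ge_2)
  have nz: "e \<noteq> 0" "e' \<noteq> 0" "b \<noteq> 0" by (simp_all add: e_def e'_def b_def axis_eq_0_iff)
  have g_add: "g (v, c) + g (v', c') = g (v + v', c + c')" for v c v' c'
    by (simp add: g_def matrix_eq_iff algebra_simps)
  have g_scale: "mat_scale a (g (v, c)) = g (a *s v, a * c)" for a v c
    by (simp add: g_def matrix_eq_iff algebra_simps)
  have g_0: "g (0, 0) = 0" by (simp add: g_def)
  have sub: "mat_subspace (range g)"
    unfolding mat_subspace_def
  proof (intro conjI ballI allI)
    show "0 \<in> range g" using g_0 by (metis rangeI)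
    fix A B c assume "A \<in> range g" "B \<in> range g"
    then obtain p p' where "A = g p" "B = g p'" by blast
    then show "A + B \<in> range g" by (cases p; cases p') (simp add: g_add)
  next
    fix A c assume "A \<in> range g"
    then obtain p where "A = g p" by blast
    then show "mat_scale c A \<in> range g" by (cases p) (simp add: g_scale)
  qed
  have g_i: "g (v, c) $ i $ k = v $ k" for v c k
    using i by (simp add: g_def e_def e'_def axis_def)
  have "inj g"
  proof (rule injI)
    fix p p' assume eq: "g p = g p'"
    obtain v c v' c' where p: "p = (v, c)" "p' = (v', c')" by (cases p; cases p')
    have "v $ k = v' $ k" for k
      using arg_cong[OF eq, of "\<lambda>A. A $ i $ k"] by (simp add: p g_i)
    then have v: "v = v'" by (simp add: vec_eq_iff)
    then have "outer e' ((c - c') *s b) = 0" using eq by (simp add: p g_def matrix_eq_iff algebra_simps)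
    then show "p = p'" using nz v p by simp
  qed
  then have "card (range g) = CARD('a) ^ (CARD('m) + 1)" by (simp add: card_image mult.commute)
  from gen_hamming_weight_le_support[OF M sub this, folded q_def]
  have "(q - 1)\<^sup>2 * gen_hamming_weight (det_code_hat M) (CARD('m) + 1)
      \<le> card {(u, v). u \<noteq> 0 \<and> v \<noteq> 0 \<and> (\<exists>f\<in>range g. lin_eval f (outer u v) \<noteq> 0)}" .
  also have "{(u, v). u \<noteq> 0 \<and> v \<noteq> 0 \<and> (\<exists>f\<in>range g. lin_eval f (outer u v) \<noteq> 0)} =
      {u. u $ i \<noteq> 0} \<times> (UNIV - {0}) \<union> {u\<in>{u. u $ i = 0}. u $ i' \<noteq> 0} \<times> {v. v $ j \<noteq> 0}"
    (is "?P = ?A \<union> ?B")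
  proof -
    have ev: "lin_eval (g (w, c)) (outer u v) = u $ i * dot w v + u $ i' * (c * v $ j)" for w c u v
      by (simp add: g_def lin_eval_add lin_eval_outer_outer e_def e'_def b_def dot_axis dot_axis_scale)
    have dot0: "dot 0 v = 0" for v :: "'a ^ 'm" by (simp add: dot_def)
    have "u \<noteq> 0 \<and> v \<noteq> 0 \<and> (\<exists>f\<in>range g. lin_eval f (outer u v) \<noteq> 0) \<longleftrightarrow>
        u $ i \<noteq> 0 \<and> v \<noteq> 0 \<or> u $ i = 0 \<and> u $ i' \<noteq> 0 \<and> v $ j \<noteq> 0" (is "?l \<longleftrightarrow> ?r") for u v
    proof
      assume ?l
      then obtain w c where "v \<noteq> 0" "u $ i * dot w v + u $ i' * (c * v $ j) \<noteq> 0" by (auto simp: ev)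
      then show ?r by auto
    next
      assume ?r
      then show ?l
      proof
        assume uv: "u $ i \<noteq> 0 \<and> v \<noteq> 0"
        then obtain w where "dot w v \<noteq> 0" using ex_dot_neq_0 by blast
        then have "lin_eval (g (w, 0)) (outer u v) \<noteq> 0" using uv by (simp add: ev)
        then show ?l using uv by auto
      next
        assume uv: "u $ i = 0 \<and> u $ i' \<noteq> 0 \<and> v $ j \<noteq> 0"
        then have "lin_eval (g (0, 1)) (outer u v) \<noteq> 0" by (simp add: ev dot0)
        then show ?l using uv by auto
      qed
    qed
    then have "?P = {(u, v). u $ i \<noteq> 0 \<and> v \<noteq> 0 \<or> u $ i = 0 \<and> u $ i' \<noteq> 0 \<and> v $ j \<noteq> 0}"
      by (simp only:)
    also have "\<dots> = ?A \<union> ?B" by blast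
    finally show ?thesis .
  qed
  also have "card (?A \<union> ?B) = card {u::'a^'l. u $ i \<noteq> 0} * (q ^ CARD('m) - 1)
      + card {u\<in>{u::'a^'l. u $ i = 0}. u $ i' \<noteq> 0} * card {v::'a^'m. v $ j \<noteq> 0}"
    by (subst card_Un_disjoint) (auto simp: card_cartesian_product card_Diff_subset q_def)
  finally have le: "(q - 1)\<^sup>2 * gen_hamming_weight (det_code_hat M) (CARD('m) + 1) \<le>
      card {u::'a^'l. u $ i \<noteq> 0} * (q ^ CARD('m) - 1)
      + card {u\<in>{u::'a^'l. u $ i = 0}. u $ i' \<noteq> 0} * card {v::'a^'m. v $ j \<noteq> 0}" .
  have c1: "q * card {u::'a^'l. u $ i \<noteq> 0} = (q - 1) * L"
    using card_nonzero_coordinate[OF vec.subspace_UNIV, of e i] by (simp add: e_def q_def L_def)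
  have c2: "q * card {v::'a^'m. v $ j \<noteq> 0} = (q - 1) * q ^ CARD('m)"
    using card_nonzero_coordinate[OF vec.subspace_UNIV, of b j] by (simp add: b_def q_def)
  \<comment> \<open>Coordinate \<open>i'\<close> is counted on the hyperplane
    \<open>u $ i = 0\<close>, which itself carries a factor 1/q; hence q appears twice.\<close>
  have c3: "q * (q * card {u\<in>{u::'a^'l. u $ i = 0}. u $ i' \<noteq> 0}) = (q - 1) * L"
  proof -
    let ?Z = "{u::'a^'l. u $ i = 0}"
    have "vec.subspace ?Z" by (rule vec.subspaceI) auto
    from card_nonzero_coordinate[OF this, of e' i'] i
    have "q * card {u\<in>?Z. u $ i' \<noteq> 0} = (q - 1) * card ?Z"
      by (simp add: e'_def q_def axis_def)
    moreover have "q * card ?Z = L"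
      using card_eq_card_kernel_times_card_image[of UNIV "\<lambda>u::'a^'l. u $ i"]
      by (simp add: L_def q_def mult.commute) (metis surj_def axis_nth)
    ultimately show ?thesis by simp
  qed
  have "q ^ 3 * ((q - 1)\<^sup>2 * gen_hamming_weight (det_code_hat M) (CARD('m) + 1)) \<le>
      q ^ 3 * (card {u::'a^'l. u $ i \<noteq> 0} * (q ^ CARD('m) - 1)
      + card {u\<in>{u::'a^'l. u $ i = 0}. u $ i' \<noteq> 0} * card {v::'a^'m. v $ j \<noteq> 0})"
    using le by (rule mult_le_mono2)
  also have "\<dots> = q\<^sup>2 * (q * card {u::'a^'l. u $ i \<noteq> 0}) * (q ^ CARD('m) - 1)
      + q * (q * card {u\<in>{u::'a^'l. u $ i = 0}. u $ i' \<noteq> 0}) * (q * card {v::'a^'m. v $ j \<noteq> 0})"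
    by (simp add: power2_eq_square power3_eq_cube distrib_left)
  also have "\<dots> = (q - 1) * (q\<^sup>2 * (L * (q ^ CARD('m) - 1)) + (q - 1) * (L * q ^ CARD('m)))"
    unfolding c1 c2 c3 by (simp only: distrib_left mult.assoc mult.left_commute)
  finally have "(q - 1) * (q ^ 3 * (q - 1) * gen_hamming_weight (det_code_hat M) (CARD('m) + 1)) \<le> \<dots>"
    by (simp only: power2_eq_square mult.assoc mult.left_commute)
  then show ?thesis using q2 by (simp add: q_def L_def)
qed

section \<open>From the scaled inequalities to the stated formulas\<close>

lemma hamming_bound_scaled:
  fixes q x Q :: real
  assumes "1 < q" "0 < x"
  shows "q ^ 3 * (q - 1) * x * (Q / (x * q) * ((x - 1) / (q - 1) + x / q\<^sup>2 - 1))
    = x * q * (q + 1) * Q - (x + q ^ 3) * Q"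
proof -
  have nz: "q \<noteq> 0" "q - 1 \<noteq> 0" "x \<noteq> 0" using assms by auto
  have "q ^ 3 * (q - 1) * x * (Q / (x * q) * ((x - 1) / (q - 1) + x / q\<^sup>2 - 1))
      = q\<^sup>2 * (q - 1) * Q * ((x - 1) / (q - 1) + x / q\<^sup>2 - 1)"
    using nz by (simp add: power2_eq_square power3_eq_cube)
  also have "\<dots> = Q * (q\<^sup>2 * (x - 1) + (q - 1) * x - q\<^sup>2 * (q - 1))"
    using nz by (simp add: distrib_left right_diff_distrib power2_eq_square) (simp add: field_simps)
  also have "\<dots> = x * q * (q + 1) * Q - (x + q ^ 3) * Q"
    by (simp add: algebra_simps power2_eq_square power3_eq_cube)
  finally show ?thesis .
qed

theorem theorem4p9:
  fixes M :: "'n::finite \<Rightarrow> 'a::{field,finite} ^ 'm::finite ^ 'l::finite"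
    and q l m :: nat and d :: "nat \<Rightarrow> nat"
  assumes q: "q = CARD('a)" and l: "l = CARD('l)" and m: "m = CARD('m)"
    and "2 \<le> l" and "l \<le> m"
    and "rank_one_representatives M"
    and d: "d = gen_hamming_weight (det_code_hat M)"
  shows "real (d m) = real q ^ (l - 1) * ((real q ^ m - 1) / (real q - 1)) \<and>
    (\<forall>r\<in>{m + 1..l * m}.
       real (d r) \<ge> real q powi (int l + int m - int r - 1) *
                      ((real q ^ r - 1) / (real q - 1) + real q ^ (r - 2) - 1) \<and>
       real q powi (int l + int m - int r - 1) *
                      ((real q ^ r - 1) / (real q - 1) + real q ^ (r - 2) - 1) =
         real (d m) + real q powi (int l + int m - int r - 1) *
                      ((real q ^ (r - m) - 1) / (real q - 1) + real q ^ (r - 2) - 1) \<and>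
       (r = m + 1 \<longrightarrow>
          real (d r) = real q powi (int l + int m - int r - 1) *
                      ((real q ^ r - 1) / (real q - 1) + real q ^ (r - 2) - 1))) \<and>
    d (m + 1) = d m + q ^ (l + m - 3)"
proof -
  note M = \<open>rank_one_representatives M\<close>
  define p where "p = real q"
  define L where "L = p ^ l"
  define y where "y = p ^ m"
  define T where "T r = p powi (int l + int m - int r - 1) * ((p ^ r - 1) / (p - 1) + p ^ (r - 2) - 1)" for r
  have q2: "2 \<le> q" unfolding q by (rule card_field_ge_2)
  have p: "1 < p" "p \<noteq> 0" "p - 1 \<noteq> 0" "real (q - 1) = p - 1" using q2 by (auto simp: p_def of_nat_diff)
  have pos: "0 < L" "0 < y" "1 \<le> q ^ m" using p q2 by (simp_all add: L_def y_def)
  have qm: "real (q ^ m - 1) = y - 1" using pos by (simp add: of_nat_diff y_def p_def)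
  have lm: "m + 1 \<le> l * m"
  proof -
    have "2 * m \<le> l * m" using assms(4) by simp
    then show ?thesis using assms(4,5) by linarith
  qed
  have attained: "\<exists>D. vec.subspace D \<and> D \<subseteq> det_code_hat M \<and> card D = CARD('a) ^ r \<and> d r = support_weight D"
    if "r \<le> l * m" for r
  proof -
    have "r \<le> vec.dim (det_code_hat M)" using that by (simp add: dim_det_code_hat[OF M] l m)
    then obtain D where "vec.subspace D" "D \<subseteq> det_code_hat M" "vec.dim D = r" "d r = support_weight D"
      using gen_hamming_weight_attained[OF det_code_hat_subspace, of r M] unfolding d by metis
    then show ?thesis using card_subspace[of D] by auto
  qed
  \<comment> \<open>The upper bound comes from a single row, the lower one from the minimum
    weight.\<close>
  have dm: "p * (p - 1) * real (d m) = L * (y - 1)"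
  proof (rule antisym)
    have "q * (q - 1) * d m \<le> q ^ l * (q ^ m - 1)"
      using gen_hamming_weight_row_le[OF M] by (simp only: q l m d)
    then have "real (q * (q - 1) * d m) \<le> real (q ^ l * (q ^ m - 1))" by (simp only: of_nat_le_iff)
    then show "p * (p - 1) * real (d m) \<le> L * (y - 1)"
      by (simp only: of_nat_mult p(4) qm of_nat_power flip: p_def) (simp only: L_def)
    obtain D where D: "vec.subspace D" "D \<subseteq> det_code_hat M" "card D = CARD('a) ^ m" "d m = support_weight D"
      using attained[OF order_trans[OF le_add1 lm]] by blast
    have "(q ^ m - 1) * (q ^ l * q ^ m) \<le> q * (q - 1) * q ^ m * d m"
      using support_weight_ge[OF M D(1-3)] by (simp only: power_add flip: q l m D(4))
    then have "q ^ m * (q ^ l * (q ^ m - 1)) \<le> q ^ m * (q * (q - 1) * d m)"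
      by (simp only: mult.assoc mult.left_commute mult.commute)
    then have "q ^ l * (q ^ m - 1) \<le> q * (q - 1) * d m" using q2 by simp
    then have "real (q ^ l * (q ^ m - 1)) \<le> real (q * (q - 1) * d m)" by (simp only: of_nat_le_iff)
    then show "L * (y - 1) \<le> p * (p - 1) * real (d m)"
      by (simp only: of_nat_mult p(4) qm of_nat_power flip: p_def) (simp only: L_def)
  qed
  have L1: "L = p * p ^ (l - 1)" using assms(4) by (simp add: L_def flip: power_Suc)
  have dm': "real (d m) = p ^ (l - 1) * ((y - 1) / (p - 1))"
  proof -
    have "p * ((p - 1) * real (d m)) = p * (p ^ (l - 1) * (y - 1))" using dm by (simp only: L1 mult.assoc)
    then have "(p - 1) * real (d m) = p ^ (l - 1) * (y - 1)" using p(2) by (simp only: mult_cancel_left) simp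
    then show ?thesis using p(3) by (simp add: eq_divide_eq mult.commute)
  qed
  \<comment> \<open>The exponent is negative for large \<open>r\<close>; the quotient form makes it
    accessible to field arithmetic.\<close>
  have powi: "p powi (int l + int m - int r - 1) = L * y / (p ^ r * p)" for r
    using p by (simp add: power_int_diff power_int_add L_def y_def)
  \<comment> \<open>The subtraction \<open>r - 2\<close> is not truncated, as 2 \<le> m < r.\<close>
  have pow2: "p ^ (r - 2) = p ^ r / p\<^sup>2" if "m < r" for r
    using that assms(4,5) p by (simp add: power_diff)
  have T: "T r = L * y / (p ^ r * p) * ((p ^ r - 1) / (p - 1) + p ^ r / p\<^sup>2 - 1)" if "m < r" for r
    using pow2[OF that] by (simp only: T_def powi)
  \<comment> \<open>After this scaling the claimed bound is exactly what
    \<open>support_weight_ge_large_dim\<close> leaves once its deficit is subtracted.\<close>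
  have scaled: "p ^ 3 * (p - 1) * p ^ r * T r = p ^ r * p * (p + 1) * (L * y) - (p ^ r + p ^ 3) * (L * y)"
    if "m < r" for r
    unfolding T[OF that] using p by (intro hamming_bound_scaled) auto
  have ge: "T r \<le> real (d r)" if r: "m < r" "r \<le> l * m" for r
  proof -
    obtain D where D: "vec.subspace D" "D \<subseteq> det_code_hat M" "card D = CARD('a) ^ r" "d r = support_weight D"
      using attained r by blast
    have "q ^ (r + 1) * (q + 1) * (q ^ l * q ^ m) \<le> q ^ 3 * (q - 1) * q ^ r * d r + (q ^ r + q ^ 3) * (q ^ l * q ^ m)"
      using support_weight_ge_large_dim[OF M D(1-3)] r assms(5) by (simp add: power_add flip: q l m D(4))
    then have "real (q ^ (r + 1) * (q + 1) * (q ^ l * q ^ m))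
        \<le> real (q ^ 3 * (q - 1) * q ^ r * d r + (q ^ r + q ^ 3) * (q ^ l * q ^ m))" by (simp only: of_nat_le_iff)
    then have "p ^ r * p * (p + 1) * (L * y) \<le> p ^ 3 * (p - 1) * p ^ r * real (d r) + (p ^ r + p ^ 3) * (L * y)"
      by (simp only: of_nat_mult of_nat_add of_nat_1 p(4) of_nat_power power_add power_one_right
          flip: p_def) (simp only: L_def y_def)
    then have "p ^ 3 * (p - 1) * p ^ r * T r \<le> p ^ 3 * (p - 1) * p ^ r * real (d r)"
      unfolding scaled[OF r(1)] by linarith
    then show ?thesis using p by simp
  qed
  \<comment> \<open>The bracketed expressions differ only in their geometric quotients, and
    q^(l+m-r-1) (q^r - q^(r-m)) / (q - 1) equals \<open>d m\<close>.\<close>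
  have eq: "T r = real (d m) + p powi (int l + int m - int r - 1) * ((p ^ (r - m) - 1) / (p - 1) + p ^ (r - 2) - 1)"
    if "m < r" for r
  proof -
    have "p ^ (r - m) = p ^ r / y" using that p by (simp add: y_def power_diff)
    moreover have "real (d m) = L * (y - 1) / (p * (p - 1))" using dm p by (simp add: field_simps)
    moreover have "L * y / (p ^ r * p) * ((p ^ r - 1) / (p - 1)) =
        L * (y - 1) / (p * (p - 1)) + L * y / (p ^ r * p) * ((p ^ r / y - 1) / (p - 1))"
    proof -
      have "L * y / (x * p) * ((x - 1) / (p - 1)) =
        L * (y - 1) / (p * (p - 1)) + L * y / (x * p) * ((x / y - 1) / (p - 1))" if "x \<noteq> 0" for x
        using that p pos by (simp add: divide_simps) (simp add: algebra_simps)
      then show ?thesis using p by simp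
    qed
    ultimately show ?thesis
      unfolding T_def powi by (simp only: distrib_left right_diff_distrib add_diff_eq add.assoc)
  qed
  have le: "real (d (m + 1)) \<le> T (m + 1)"
  proof -
    have "q ^ 3 * (q - 1) * d (m + 1) \<le> q\<^sup>2 * (q ^ l * (q ^ m - 1)) + (q - 1) * (q ^ l * q ^ m)"
      using gen_hamming_weight_row_plus_entry_le[OF M] assms(4) by (simp only: q l m d)
    then have "real (q ^ 3 * (q - 1) * d (m + 1)) \<le> real (q\<^sup>2 * (q ^ l * (q ^ m - 1)) + (q - 1) * (q ^ l * q ^ m))"
      by (simp only: of_nat_le_iff)
    then have "p ^ 3 * (p - 1) * real (d (m + 1)) \<le> p\<^sup>2 * (L * (y - 1)) + (p - 1) * (L * y)"
      by (simp only: of_nat_mult of_nat_add p(4) qm of_nat_power flip: p_def) (simp only: L_def y_def)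
    \<comment> \<open>The factor \<open>p * y\<close> is q^(m+1), the power that
      \<open>scaled\<close> carries for r = m + 1.\<close>
    then have "p * y * (p ^ 3 * (p - 1) * real (d (m + 1))) \<le> p * y * (p\<^sup>2 * (L * (y - 1)) + (p - 1) * (L * y))"
      using p pos by (intro mult_left_mono) auto
    also have "\<dots> = p ^ 3 * (p - 1) * p ^ (m + 1) * T (m + 1)"
      unfolding scaled[OF less_add_one] by (simp add: algebra_simps power2_eq_square power3_eq_cube flip: y_def)
    finally have "p ^ 3 * (p - 1) * p ^ (m + 1) * real (d (m + 1)) \<le> p ^ 3 * (p - 1) * p ^ (m + 1) * T (m + 1)"
      by (simp add: y_def mult_ac)
    then show ?thesis using p by simp
  qed
  have eq1: "real (d (m + 1)) = T (m + 1)" using le ge[of "m + 1"] lm by simp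
  \<comment> \<open>For r = m + 1 the geometric quotient is 1 and cancels the - 1, leaving q^(l-2)
    q^(m-1).\<close>
  have "T (m + 1) = real (d m) + p ^ (l + m - 3)"
  proof -
    have "p ^ (l + m - 3) = L * y / p ^ 3" using p assms(4,5) by (simp add: power_diff power_add L_def y_def)
    moreover have "L * y / (p ^ (m + 1) * p) * ((p ^ (m + 1 - m) - 1) / (p - 1) + p ^ (m + 1) / p\<^sup>2 - 1) = L * y / p ^ 3"
      using p pos by (simp add: y_def field_simps power2_eq_square power3_eq_cube)
    ultimately show ?thesis unfolding eq[OF less_add_one] powi pow2[OF less_add_one] by simp
  qed
  then have "real (d (m + 1)) = real (d m + q ^ (l + m - 3))" unfolding eq1 by (simp add: p_def)
  then have "d (m + 1) = d m + q ^ (l + m - 3)" by (simp only: of_nat_eq_iff)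
  moreover have "T r \<le> real (d r) \<and>
      T r = real (d m) + p powi (int l + int m - int r - 1) * ((p ^ (r - m) - 1) / (p - 1) + p ^ (r - 2) - 1) \<and>
      (r = m + 1 \<longrightarrow> real (d r) = T r)" if "r \<in> {m + 1..l * m}" for r
    using that ge eq eq1 by auto
  ultimately show ?thesis using dm' unfolding T_def y_def p_def by blast
qed

end
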